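(* Let $n\ge2$, $A\ge1$ and $B>0$. There exists a constant $p_0=p_0(n,A,B)>0$, depending only on $n,A,B$, such that every conformal density $\rho:\mathbb{B}^n\to(0,\infty)$ satisfying HI$(A)$ and VG$(B)$ belongs to $H^p$ for all $0<p<p_0$.
   Context: Notation: $\mathbb{B}^n=\{x\in\mathbb{R}^n:|x|<1\}$, $\mathbb{S}^{n-1}=\{x\in\mathbb{R}^n:|x|=1\}$, $\sigma$ is the $(n-1)$-dimensional surface measure on $\mathbb{S}^{n-1}$, and $B_x=B(x,(1-|x|)/2)$ (Euclidean ball) for $x\in\mathbb{B}^n$. For a continuous function $\rho:\mathbb{B}^n\to(0,\infty)$, put $\mathrm{length}_\rho(\gamma)=\int_\gamma\rho\,ds$ (arc length integration) for a curve $\gamma$. For $x,y\in\mathbb{B}^n$ let $d_\rho(x,y)=\inf\mathrm{length}_\rho(\gamma)$, the infimum over all curves $\gamma\subset\mathbb{B}^n$ with endpoints $x$ and $y$. Write $|x|_\rho=d_\rho(x,0)$ and $B_\rho(x,r)=\{y\in\mathbb{B}^n:d_\rho(x,y)<r\}$. $\rho$ satisfies HI$(A)$, $A\ge1$, if for every $z\in\mathbb{B}^n$: $1/A\le\rho(x)/\rho(y)\le A$ for all $x,y\in B_z$. $\rho$ satisfies VG$(B)$, $B>0$, if $\int_{B_\rho(x,r)}\rho^n\,dx\le Br^n$ for all $x\in\mathbb{B}^n$, $r>0$. A conformal density on $\mathbb{B}^n$ is a continuous $\rho:\mathbb{B}^n\to(0,\infty)$ satisfying HI$(A)$ and VG$(B)$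 for some $A\ge1$, $B>0$. For $0<p<\infty$, $\rho\in H^p$ means that there is $\delta>0$ with $\sup_{0<r<1}\int_{\mathbb{S}^{n-1}}(\delta|r\omega|_\rho)^p\,d\sigma(\omega)<\infty$. *)

theory Defs
  imports "HOL-Analysis.Analysis"
begin

section \<open>Arc length\<close>

definition arc_length :: "(real \<Rightarrow> 'a::metric_space) \<Rightarrow> real \<Rightarrow> real \<Rightarrow> ennreal" where
  "arc_length \<gamma> s t =
     (SUP ts \<in> {ts. sorted ts \<and> set ts \<subseteq> {s..t}}.
        \<Sum>i<length ts - 1. ennreal (dist (\<gamma> (ts ! i)) (\<gamma> (ts ! Suc i))))"

definition rectifiable :: "(real \<Rightarrow> 'a::metric_space) \<Rightarrow> bool" where
  "rectifiable \<gamma> \<longleftrightarrow> path \<gamma> \<and> arc_length \<gamma> 0 1 < \<infinity>"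

text \<open>
  For a rectifiable path the map \<open>t \<mapsto> arc_length \<gamma> 0 t\<close> is continuous and nondecreasing on
  \<open>[0,1]\<close>, and \<open>\<gamma>\<close> is constant wherever this map is. So for \<open>0 \<le> u \<le> arc_length \<gamma> 0 1\<close> a
  suitable \<open>t\<close> exists, and the value below does not depend on its choice.
\<close>

definition arc_length_param :: "(real \<Rightarrow> 'a::metric_space) \<Rightarrow> real \<Rightarrow> 'a" where
  "arc_length_param \<gamma> u = \<gamma> (SOME t. t \<in> {0..1} \<and> arc_length \<gamma> 0 t = ennreal u)"

definition rho_length :: "('a::metric_space \<Rightarrow> real) \<Rightarrow> (real \<Rightarrow> 'a) \<Rightarrow> ennreal" where
  "rho_length \<rho> \<gamma> =
     (if rectifiable \<gamma>
      then \<integral>\<^sup>+ u \<in> {0..enn2real (arc_length \<gamma> 0 1)}. ennreal (\<rho> (arc_length_param \<gamma> u)) \<partial>lborel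
      else \<infinity>)"

section \<open>The metric of a density on the unit ball\<close>

text \<open>
  A density is a total function of which only the values on \<open>ball 0 1\<close> matter. For a positive
  continuous \<open>\<rho>\<close> and \<open>x\<close>, \<open>y\<close> in the unit ball the infimum is finite (consider the segment),
  so that \<open>enn2real\<close> loses nothing.
\<close>

definition rho_dist ::
    "(real ^ 'n::finite \<Rightarrow> real) \<Rightarrow> real ^ 'n \<Rightarrow> real ^ 'n \<Rightarrow> real" where
  "rho_dist \<rho> x y =
     enn2real (INF \<gamma> \<in> {\<gamma>. path \<gamma> \<and> path_image \<gamma> \<subseteq> ball 0 1 \<and> pathstart \<gamma> = x \<and> pathfinish \<gamma> = y}.
       rho_length \<rho> \<gamma>)"

definition rho_norm :: "(real ^ 'n::finite \<Rightarrow> real) \<Rightarrow> real ^ 'n \<Rightarrow> real" where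
  "rho_norm \<rho> x = rho_dist \<rho> x 0"

definition rho_ball ::
    "(real ^ 'n::finite \<Rightarrow> real) \<Rightarrow> real ^ 'n \<Rightarrow> real \<Rightarrow> (real ^ 'n) set" where
  "rho_ball \<rho> x r = {y \<in> ball 0 1. rho_dist \<rho> x y < r}"

section \<open>Conformal densities\<close>

definition whitney_ball :: "real ^ 'n::finite \<Rightarrow> (real ^ 'n) set" where
  "whitney_ball x = ball x ((1 - norm x) / 2)"

definition satisfies_HI :: "real \<Rightarrow> (real ^ 'n::finite \<Rightarrow> real) \<Rightarrow> bool" where
  "satisfies_HI A \<rho> \<longleftrightarrow>
     (\<forall>z \<in> ball 0 1. \<forall>x \<in> whitney_ball z. \<forall>y \<in> whitney_ball z.
        1 / A \<le> \<rho> x / \<rho> y \<and> \<rho> x / \<rho> y \<le> A)"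

definition satisfies_VG :: "real \<Rightarrow> (real ^ 'n::finite \<Rightarrow> real) \<Rightarrow> bool" where
  "satisfies_VG B \<rho> \<longleftrightarrow>
     (\<forall>x \<in> ball 0 1. \<forall>r > 0.
        (\<integral>\<^sup>+ y \<in> rho_ball \<rho> x r. ennreal (\<rho> y ^ CARD('n)) \<partial>lborel) \<le> ennreal (B * r ^ CARD('n)))"

definition conformal_density :: "(real ^ 'n::finite \<Rightarrow> real) \<Rightarrow> bool" where
  "conformal_density \<rho> \<longleftrightarrow>
     continuous_on (ball 0 1) \<rho> \<and> (\<forall>x \<in> ball 0 1. \<rho> x > 0) \<and>
     (\<exists>A \<ge> 1. satisfies_HI A \<rho>) \<and> (\<exists>B > 0. satisfies_VG B \<rho>)"

section \<open>Hardy spaces\<close>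

text \<open>
  Surface measure on the unit sphere, as in polar coordinates: the measure of \<open>E\<close> is \<open>n\<close> times
  the volume of the part of the unit ball in the cone over \<open>E\<close>. It is a Borel measure on the whole
  space, concentrated on the sphere (the center of the ball is a null set).
\<close>

definition sphere_measure :: "(real ^ 'n::finite) measure" where
  "sphere_measure =
     scale_measure (ennreal (real CARD('n)))
       (distr (restrict_space lborel (ball 0 1)) borel (\<lambda>x. x /\<^sub>R norm x))"

lemma emeasure_sphere_measure:
  fixes E :: "(real ^ 'n::finite) set"
  assumes "E \<in> sets borel"
  shows "emeasure sphere_measure E =
           ennreal (real CARD('n)) * emeasure lborel {x \<in> ball 0 1. x /\<^sub>R norm x \<in> E}"
proof -
  have m: "(\<lambda>x::real ^ 'n. x /\<^sub>R norm x) \<in> borel_measurable (restrict_space lborel (ball 0 1))"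
    by (rule measurable_restrict_space1) measurable
  let ?S = "{x \<in> ball 0 1. x /\<^sub>R norm x \<in> E}"
  have "(\<lambda>x::real ^ 'n. x /\<^sub>R norm x) -` E \<inter> ball 0 1 = ?S"
    by auto
  moreover have "emeasure (restrict_space lborel (ball 0 1)) ?S = emeasure lborel ?S"
    by (rule emeasure_restrict_space) auto
  ultimately show ?thesis
    using assms m
    by (simp add: sphere_measure_def emeasure_distr space_restrict_space del: mem_ball mem_ball_0)
qed

definition in_Hp :: "real \<Rightarrow> (real ^ 'n::finite \<Rightarrow> real) \<Rightarrow> bool" where
  "in_Hp p \<rho> \<longleftrightarrow>
     (\<exists>\<delta> > 0.
        (SUP r \<in> {0<..<1}.
           \<integral>\<^sup>+ \<omega> \<in> sphere 0 1. ennreal ((\<delta> * rho_norm \<rho> (r *\<^sub>R \<omega>)) powr p) \<partial>sphere_measure) < \<infinity>)"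

end

theory Submission
  imports Defs
begin

text \<open>
  Integrating \<open>\<rho>\<close> along radii gives a majorant of \<open>|x|\<^sub>\<rho>\<close>; let \<open>f\<close> be \<open>\<rho> 0\<close> plus this majorant. By HI,
  \<open>f\<close> and \<open>\<rho>\<close> are essentially constant on Whitney balls, and since the sublevel sets of \<open>f\<close> lie in
  \<open>\<rho>\<close>-balls, VG bounds the energy \<open>\<integral> (\<rho>/f)\<^sup>n\<close> over \<open>{f < e\<^sup>m \<rho> 0}\<close> by a multiple of \<open>m\<close>. Let \<open>z j\<close>
  be the points at distance \<open>(3/4)\<^sup>j\<close> from the sphere on a fixed radius. The increment \<open>a j\<close> of
  \<open>log f\<close> from \<open>z j\<close> to \<open>z (j+1)\<close> satisfies \<open>(a j)\<^sup>n \<le> C\<close> times the energy of a small ball about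
  \<open>z j\<close>, and these balls lie in disjoint shells. If \<open>log (f / \<rho> 0)\<close> exceeds \<open>M\<close> on the radius, then
  \<open>M \<le> \<Sum> a j\<close>, which Young's inequality with weights \<open>T (3/4)\<^bsup>max(j - J, 0)\<^esup>\<close>, \<open>M = 2 T (J + 4)\<close>,
  turns into a lower bound for a sum of weighted energies. For \<open>T\<close> large the energy bound absorbs the
  terms \<open>j < J\<close>, so the terms \<open>j \<ge> J\<close> have sum at least \<open>M/4\<close>. Integrating these over all
  directions gains \<open>(3/4)\<^sup>J\<close>, because a point of the \<open>j\<close>-th shell is seen only by a cap of measure
  \<open>C (3/4)\<^bsup>j(n-1)\<^esup>\<close>. Hence the set of directions with \<open>f > e\<^sup>M \<rho> 0\<close> has measure \<open>\<le> C e\<^bsup>-cM\<^esup>\<close>, with \<open>c\<close>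
  depending only on \<open>n\<close>, \<open>A\<close>, \<open>B\<close>.
\<close>

section \<open>Length of segments\<close>

lemma dist_linepath: "dist (linepath x y a) (linepath x y b) = \<bar>b - a\<bar> * dist x y"
  for x y :: "'a::real_normed_vector"
proof -
  have "linepath x y a - linepath x y b = (b - a) *\<^sub>R (x - y)"
    by (simp add: linepath_def algebra_simps)
  then show ?thesis by (simp add: dist_norm)
qed

lemma sum_sorted_increments_le:
  fixes ts :: "real list"
  assumes "sorted ts" "set ts \<subseteq> {s..t}" "s \<le> t"
  shows "(\<Sum>i<length ts - 1. ts ! Suc i - ts ! i) \<le> t - s"
proof (cases ts)
  case (Cons a as)
  have "(\<Sum>i<length as. ts ! Suc i - ts ! i) = ts ! length as - ts ! 0"
    by (rule sum_lessThan_telescope)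
  moreover have "ts ! length as \<in> set ts" "ts ! 0 \<in> set ts"
    by (rule nth_mem, simp add: Cons)+
  ultimately show ?thesis using assms Cons by fastforce
qed (use assms in auto)

text \<open>Chords of an affine path are proportional to parameter increments, so sums over
  partitions telescope; \<open>[s, t]\<close> attains the supremum.\<close>

lemma arc_length_linepath:
  fixes x y :: "'a::real_normed_vector"
  assumes "s \<le> t"
  shows "arc_length (linepath x y) s t = ennreal ((t - s) * dist x y)"
proof (rule antisym)
  show "arc_length (linepath x y) s t \<le> ennreal ((t - s) * dist x y)"
    unfolding arc_length_def
  proof (rule SUP_least, clarify)
    fix ts :: "real list" assume ts: "sorted ts" "set ts \<subseteq> {s..t}"
    have "(\<Sum>i<length ts - 1. ennreal (dist (linepath x y (ts ! i)) (linepath x y (ts ! Suc i))))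
      = (\<Sum>i<length ts - 1. ennreal ((ts ! Suc i - ts ! i) * dist x y))"
      using ts by (intro sum.cong refl) (simp add: dist_linepath sorted_nth_mono)
    also have "\<dots> = ennreal ((\<Sum>i<length ts - 1. ts ! Suc i - ts ! i) * dist x y)"
      unfolding sum_distrib_right using ts by (intro sum_ennreal) (simp add: sorted_nth_mono)
    also have "\<dots> \<le> ennreal ((t - s) * dist x y)"
      using sum_sorted_increments_le[OF ts assms] by (intro ennreal_leI mult_right_mono) auto
    finally show "(\<Sum>i<length ts - 1. ennreal (dist (linepath x y (ts ! i)) (linepath x y (ts ! Suc i))))
      \<le> ennreal ((t - s) * dist x y)" .
  qed
  show "ennreal ((t - s) * dist x y) \<le> arc_length (linepath x y) s t"
    unfolding arc_length_def
    by (rule SUP_upper2[of "[s, t]"]) (use assms in \<open>auto simp: dist_linepath\<close>)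
qed

text \<open>For \<open>x \<noteq> y\<close> the arc length of the segment is injective in
  \<open>t\<close>, so the choice in \<open>arc_length_param\<close> is forced.\<close>

lemma arc_length_param_linepath:
  fixes x y :: "'a::real_normed_vector"
  assumes "x \<noteq> y" "u \<in> {0..dist x y}"
  shows "arc_length_param (linepath x y) u = linepath x y (u / dist x y)"
proof -
  have "(SOME t. t \<in> {0..1} \<and> arc_length (linepath x y) 0 t = ennreal u) = u / dist x y"
  proof (rule some_equality)
    show "u / dist x y \<in> {0..1} \<and> arc_length (linepath x y) 0 (u / dist x y) = ennreal u"
      using assms by (auto simp: arc_length_linepath divide_simps)
  next
    fix t assume t: "t \<in> {0..1} \<and> arc_length (linepath x y) 0 t = ennreal u"
    then have "t * dist x y = u" using assms by (auto simp: arc_length_linepath)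
    then show "t = u / dist x y" using assms by (simp add: field_simps)
  qed
  then show ?thesis by (simp add: arc_length_param_def)
qed

text \<open>Substitution \<open>u = t * dist x y\<close>. It breaks down for a degenerate segment,
  where both sides vanish.\<close>

lemma rho_length_linepath:
  fixes x y :: "'a::real_normed_vector"
  assumes cont: "continuous_on (closed_segment x y) \<rho>"
    and nonneg: "\<And>z. z \<in> closed_segment x y \<Longrightarrow> 0 \<le> \<rho> z"
  shows "rho_length \<rho> (linepath x y) = ennreal (dist x y * integral {0..1} (\<lambda>t. \<rho> (linepath x y t)))"
proof -
  have rect: "rectifiable (linepath x y)"
    by (simp add: rectifiable_def arc_length_linepath)
  let ?L = "dist x y"
  have c1: "continuous_on {0..1} (\<lambda>t. \<rho> (linepath x y t))"
    by (rule continuous_on_compose2[OF cont]) (auto simp: linepath_in_path intro: continuous_on_linepath)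
  show ?thesis
  proof (cases "x = y")
    case True
    have "(\<integral>\<^sup>+ u \<in> {0::real}. ennreal (\<rho> (arc_length_param (linepath x y) u)) \<partial>lborel) = 0"
      by (intro nn_integral_0_iff_AE[THEN iffD2] nn_integral_null_set) auto
    then show ?thesis using rect True by (simp add: rho_length_def arc_length_linepath)
  next
    case False
    then have L: "?L > 0" by simp
    have i1: "((\<lambda>t. \<rho> (linepath x y t)) has_integral integral {0..1} (\<lambda>t. \<rho> (linepath x y t))) (cbox 0 1)"
      using integrable_continuous_real[OF c1] by (simp add: integrable_integral)
    have i2: "((\<lambda>u. \<rho> (linepath x y (u / ?L))) has_integral ?L * integral {0..1} (\<lambda>t. \<rho> (linepath x y t))) {0..?L}"
      using has_integral_affinity'[OF i1, of "1 / ?L" 0] L by (simp add: divide_simps)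
    \<comment> \<open>Extension by zero to a Borel function on the line lets the gauge integral be
      read as a Lebesgue integral.\<close>
    define g where "g u = indicator {0..?L} u *\<^sub>R \<rho> (linepath x y (u / ?L))" for u
    have seg: "linepath x y (u / ?L) \<in> closed_segment x y" if "u \<in> {0..?L}" for u
      using that L by (intro linepath_in_path) (auto simp: divide_simps)
    have gm: "g \<in> borel_measurable borel" unfolding g_def
      by (rule borel_measurable_continuous_on_indicator, simp,
          rule continuous_on_compose2[OF cont])
         (use L seg in \<open>auto simp: linepath_def intro!: continuous_intros\<close>)
    have "(g has_integral ?L * integral {0..1} (\<lambda>t. \<rho> (linepath x y t))) UNIV"
      using i2 unfolding has_integral_restrict_UNIV[of "{0..?L}", symmetric]
      by (rule has_integral_eq[rotated]) (auto simp: g_def)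
    then have "(\<integral>\<^sup>+ u. ennreal (g u) \<partial>lborel) = ennreal (?L * integral {0..1} (\<lambda>t. \<rho> (linepath x y t)))"
      by (rule nn_integral_has_integral_lborel[OF gm _, rotated])
        (unfold g_def indicator_def, use nonneg seg in auto)
    moreover have "(\<integral>\<^sup>+ u. ennreal (g u) \<partial>lborel) =
        (\<integral>\<^sup>+ u \<in> {0..?L}. ennreal (\<rho> (arc_length_param (linepath x y) u)) \<partial>lborel)"
      by (intro nn_integral_cong) (auto simp: g_def indicator_def arc_length_param_linepath[OF False])
    ultimately show ?thesis using rect by (simp add: rho_length_def arc_length_linepath)
  qed
qed

text \<open>The segment is one competitor in the infimum. Apart from nonnegativity, this upper bound
  is all that the proof uses about \<open>rho_dist\<close>.\<close>

lemma rho_dist_le_linepath: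
  fixes \<rho> :: "real ^ 'n::finite \<Rightarrow> real"
  assumes cont: "continuous_on (ball 0 1) \<rho>" and pos: "\<And>z. z \<in> ball 0 1 \<Longrightarrow> 0 < \<rho> z"
    and xy: "x \<in> ball 0 1" "y \<in> ball 0 1"
  shows "rho_dist \<rho> x y \<le> dist x y * integral {0..1} (\<lambda>t. \<rho> (linepath x y t))"
proof -
  have seg: "closed_segment x y \<subseteq> ball 0 1"
    using xy by (intro closed_segment_subset convex_ball) auto
  have mem: "linepath x y t \<in> ball 0 1" if "t \<in> {0..1}" for t
    using seg linepath_in_path[OF that] by blast
  have "0 \<le> integral {0..1} (\<lambda>t. \<rho> (linepath x y t))"
    using mem pos by (intro integral_nonneg integrable_continuous_real
        continuous_on_compose2[OF cont] continuous_on_linepath) (auto simp: less_imp_le)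
  moreover have "(INF \<gamma> \<in> {\<gamma>. path \<gamma> \<and> path_image \<gamma> \<subseteq> ball 0 1 \<and> pathstart \<gamma> = x \<and> pathfinish \<gamma> = y}.
       rho_length \<rho> \<gamma>) \<le> rho_length \<rho> (linepath x y)"
    using seg by (intro INF_lower) auto
  moreover have "rho_length \<rho> (linepath x y) =
      ennreal (dist x y * integral {0..1} (\<lambda>t. \<rho> (linepath x y t)))"
    using seg pos by (intro rho_length_linepath continuous_on_subset[OF cont]) (auto simp: less_imp_le)
  ultimately show ?thesis
    unfolding rho_dist_def by (intro enn2real_leI) auto
qed

section \<open>Radial growth of a density\<close>

locale harnack_density =
  fixes \<rho> :: "real ^ 'n::finite \<Rightarrow> real" and A :: real
  assumes cont: "continuous_on (ball 0 1) \<rho>"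
    and pos: "\<And>z. norm z < 1 \<Longrightarrow> 0 < \<rho> z"
    and A_ge_1: "1 \<le> A"
    and HI: "satisfies_HI A \<rho>"
begin

text \<open>Parametrizing every radius by \<open>{0..1}\<close> allows two radii to be compared at
  equal \<open>t\<close> and makes continuity in \<open>x\<close> a statement about a parameter
  integral.\<close>

definition radial_mean :: "real ^ 'n \<Rightarrow> real" where
  "radial_mean x = integral {0..1} (\<lambda>t. \<rho> (t *\<^sub>R x))"

text \<open>The summand \<open>\<rho> 0\<close> keeps the quotient \<open>\<rho> / growth\<close> bounded near the center.\<close>

definition growth :: "real ^ 'n \<Rightarrow> real" where
  "growth x = \<rho> 0 + norm x * radial_mean x"

lemma mult_norm_less_1: "norm x < 1 \<Longrightarrow> 0 \<le> t \<Longrightarrow> t \<le> 1 \<Longrightarrow> t * norm x < 1" for x :: "real ^ 'n"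
  using mult_left_le_one_le[of "norm x" t] by simp

lemma continuous_on_ray:
  assumes "norm x < 1"
  shows "continuous_on {0..1} (\<lambda>t. \<rho> (t *\<^sub>R x))"
  by (rule continuous_on_compose2[OF cont])
     (use assms in \<open>auto intro!: continuous_intros mult_norm_less_1\<close>)

lemma integrable_ray: "norm x < 1 \<Longrightarrow> (\<lambda>t. \<rho> (t *\<^sub>R x)) integrable_on {0..1}"
  by (intro integrable_continuous_real continuous_on_ray)

lemma radial_mean_nonneg: "norm x < 1 \<Longrightarrow> 0 \<le> radial_mean x"
  unfolding radial_mean_def
  by (intro integral_nonneg integrable_ray less_imp_le[OF pos]) (auto intro!: mult_norm_less_1)

lemma growth_ge: "norm x < 1 \<Longrightarrow> \<rho> 0 \<le> growth x"
  by (simp add: growth_def radial_mean_nonneg)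

lemma growth_pos: "norm x < 1 \<Longrightarrow> 0 < growth x"
  using growth_ge[of x] pos[of 0] by simp

lemma growth_0: "growth 0 = \<rho> 0"
  by (simp add: growth_def)

lemma continuous_on_growth: "continuous_on (ball 0 1) growth"
proof -
  have "continuous_on (ball 0 1 \<times> cbox 0 1) (\<lambda>(x, t). \<rho> (t *\<^sub>R x))"
    unfolding case_prod_unfold
    by (rule continuous_on_compose2[OF cont])
       (auto intro!: continuous_intros mult_norm_less_1)
  then have "continuous_on (ball 0 1) (\<lambda>x. integral (cbox 0 1) (\<lambda>t. \<rho> (t *\<^sub>R x)))"
    by (rule integral_continuous_on_param)
  then have "continuous_on (ball 0 1) radial_mean"
    by (simp add: radial_mean_def[abs_def])
  then show ?thesis
    unfolding growth_def[abs_def] by (intro continuous_intros)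
qed

lemma rho_dist_0_le: "rho_dist \<rho> 0 x \<le> norm x * radial_mean x" if x: "norm x < 1"
proof -
  have "rho_dist \<rho> 0 x \<le> dist 0 x * integral {0..1} (\<lambda>t. \<rho> (linepath 0 x t))"
    using x by (intro rho_dist_le_linepath cont pos) auto
  then show ?thesis by (simp add: linepath_def radial_mean_def)
qed

text \<open>Instead of proving \<open>rho_dist\<close> symmetric, the integral over the segment from
  \<open>x\<close> to \<open>0\<close> is reflected by \<open>t \<mapsto> 1 - t\<close>.\<close>

lemma rho_norm_le: "rho_norm \<rho> x \<le> norm x * radial_mean x" if x: "norm x < 1"
proof -
  have "rho_norm \<rho> x \<le> dist x 0 * integral {0..1} (\<lambda>t. \<rho> (linepath x 0 t))"
    unfolding rho_norm_def using x by (intro rho_dist_le_linepath cont pos) auto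
  also have "integral {0..1} (\<lambda>t. \<rho> (linepath x 0 t)) = integral {0..1} (\<lambda>t. \<rho> ((1 - t) *\<^sub>R x))"
    by (simp add: linepath_def)
  also have "\<dots> = radial_mean x"
  proof -
    have "((\<lambda>t. \<rho> (t *\<^sub>R x)) has_integral radial_mean x) (cbox 0 1)"
      using integrable_ray[OF x] by (simp add: radial_mean_def integrable_integral)
    from has_integral_affinity[OF this, of "-1" 1]
    have "((\<lambda>t. \<rho> ((1 - t) *\<^sub>R x)) has_integral radial_mean x) ((\<lambda>t. 1 - t) ` {0..1})"
      by simp
    then show ?thesis by (simp add: image_diff_atLeastAtMost integral_unique)
  qed
  finally show ?thesis by simp
qed

text \<open>Rescaling to arc length on the radius, so that increments of \<open>growth\<close>
  become integrals over subintervals.\<close>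

lemma growth_scaleR_unit:
  assumes "norm \<omega> = 1" "0 \<le> s" "s < 1"
  shows "growth (s *\<^sub>R \<omega>) = \<rho> 0 + integral {0..s} (\<lambda>t. \<rho> (t *\<^sub>R \<omega>))"
proof (cases "s = 0")
  case False
  then have s: "s > 0" using assms by simp
  have "continuous_on {0..s} (\<lambda>t. \<rho> (t *\<^sub>R \<omega>))"
    by (rule continuous_on_compose2[OF cont]) (use assms in \<open>auto intro!: continuous_intros\<close>)
  then have "((\<lambda>t. \<rho> (t *\<^sub>R \<omega>)) has_integral integral {0..s} (\<lambda>t. \<rho> (t *\<^sub>R \<omega>))) (cbox 0 s)"
    by (simp add: integrable_continuous_real integrable_integral)
  from has_integral_affinity'[OF this s, of 0]
  have "((\<lambda>t. \<rho> (t *\<^sub>R s *\<^sub>R \<omega>)) has_integral integral {0..s} (\<lambda>t. \<rho> (t *\<^sub>R \<omega>)) / s) {0..1}"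
    using s by (simp add: field_simps)
  then show ?thesis
    using s assms by (simp add: growth_def radial_mean_def integral_unique)
qed (simp add: growth_0)

lemma growth_radial_step:
  assumes "norm \<omega> = 1" "0 \<le> s" "s \<le> t" "t < 1"
  shows "growth (t *\<^sub>R \<omega>) = growth (s *\<^sub>R \<omega>) + integral {s..t} (\<lambda>u. \<rho> (u *\<^sub>R \<omega>))"
    and "(\<lambda>u. \<rho> (u *\<^sub>R \<omega>)) integrable_on {s..t}"
proof -
  have c: "continuous_on {0..t} (\<lambda>u. \<rho> (u *\<^sub>R \<omega>))"
    by (rule continuous_on_compose2[OF cont]) (use assms in \<open>auto intro!: continuous_intros\<close>)
  have "integral {0..s} (\<lambda>u. \<rho> (u *\<^sub>R \<omega>)) + integral {s..t} (\<lambda>u. \<rho> (u *\<^sub>R \<omega>))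
      = integral {0..t} (\<lambda>u. \<rho> (u *\<^sub>R \<omega>))"
    using assms c by (intro Henstock_Kurzweil_Integration.integral_combine integrable_continuous_real) auto
  then show "growth (t *\<^sub>R \<omega>) = growth (s *\<^sub>R \<omega>) + integral {s..t} (\<lambda>u. \<rho> (u *\<^sub>R \<omega>))"
    using assms by (simp add: growth_scaleR_unit)
  show "(\<lambda>u. \<rho> (u *\<^sub>R \<omega>)) integrable_on {s..t}"
    by (intro integrable_continuous_real continuous_on_subset[OF c]) (use assms in auto)
qed

lemma growth_radial_mono:
  assumes "norm \<omega> = 1" "0 \<le> s" "s \<le> t" "t < 1"
  shows "growth (s *\<^sub>R \<omega>) \<le> growth (t *\<^sub>R \<omega>)"
proof -
  have "0 \<le> integral {s..t} (\<lambda>u. \<rho> (u *\<^sub>R \<omega>))"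
    by (intro integral_nonneg growth_radial_step less_imp_le[OF pos]) (use assms in auto)
  then show ?thesis using growth_radial_step(1)[OF assms] by simp
qed

section \<open>Harnack inequalities for the density and its growth\<close>

text \<open>The center of a Whitney ball lies in it, so HI compares \<open>\<rho> z\<close> with
  \<open>\<rho> y\<close> in both directions.\<close>

lemma harnack:
  assumes "norm z < 1" "y \<in> whitney_ball z"
  shows "\<rho> y \<le> A * \<rho> z" "\<rho> z \<le> A * \<rho> y"
proof -
  have z: "z \<in> whitney_ball z" using assms by (simp add: whitney_ball_def)
  have "norm y \<le> norm z + dist z y" by (metis dist_norm norm_triangle_sub dist_commute)
  also have "\<dots> < 1" using assms by (simp add: whitney_ball_def field_simps)
  finally have y: "norm y < 1" .
  have "\<rho> y / \<rho> z \<le> A" "\<rho> z / \<rho> y \<le> A"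
    using HI assms z unfolding satisfies_HI_def by (auto simp del: mem_ball)
  then show "\<rho> y \<le> A * \<rho> z" "\<rho> z \<le> A * \<rho> y"
    using pos[OF y] pos[OF assms(1)] by (simp_all add: divide_le_eq)
qed

text \<open>A step of a quarter of the distance to the sphere stays in the Whitney ball of its
  starting point and leaves \<open>1 - t = 3 / 4 * (1 - s)\<close>. This is the origin of the ratio
  \<open>3 / 4\<close>.\<close>

lemma growth_step:
  assumes "norm \<omega> = 1" "0 \<le> s" "s < 1" "t = s + (1 - s) / 4"
  shows "growth (t *\<^sub>R \<omega>) \<le> growth (s *\<^sub>R \<omega>) + A * \<rho> (s *\<^sub>R \<omega>) * ((1 - s) / 4)"
proof -
  have st: "s \<le> t" "t < 1" using assms by (auto simp: field_simps)
  have "integral {s..t} (\<lambda>u. \<rho> (u *\<^sub>R \<omega>)) \<le> integral {s..t} (\<lambda>u. A * \<rho> (s *\<^sub>R \<omega>))"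
  proof (intro integral_le growth_radial_step st assms)
    fix u assume u: "u \<in> {s..t}"
    have "dist (s *\<^sub>R \<omega>) (u *\<^sub>R \<omega>) = \<bar>s - u\<bar> * norm \<omega>"
      by (simp add: dist_norm flip: scaleR_left_diff_distrib)
    moreover have "u - s < (1 - s) / 2"
      using u assms(3,4) by (auto simp: field_simps)
    ultimately have "u *\<^sub>R \<omega> \<in> whitney_ball (s *\<^sub>R \<omega>)"
      using u assms by (simp add: whitney_ball_def)
    then show "\<rho> (u *\<^sub>R \<omega>) \<le> A * \<rho> (s *\<^sub>R \<omega>)"
      using assms by (intro harnack) auto
  qed auto
  also have "\<dots> = A * \<rho> (s *\<^sub>R \<omega>) * ((1 - s) / 4)" using st assms by simp
  finally show ?thesis using growth_radial_step(1)[OF assms(1,2) st] by simp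
qed

text \<open>Scaling by \<open>t\<close> shrinks the distance of \<open>z\<close> and
  \<open>y\<close> and enlarges the Whitney ball, so HI applies at every \<open>t\<close>.\<close>

lemma radial_mean_harnack:
  assumes z: "norm z < 1" and y: "y \<in> whitney_ball z" "norm y < 1"
  shows "radial_mean y \<le> A * radial_mean z"
proof -
  have "radial_mean y \<le> integral {0..1} (\<lambda>t. A * \<rho> (t *\<^sub>R z))"
    unfolding radial_mean_def
  proof (intro integral_le integrable_ray integrable_on_mult_right y z)
    fix t :: real assume t: "t \<in> {0..1}"
    have "dist (t *\<^sub>R z) (t *\<^sub>R y) = t * dist z y"
      using t by (simp add: dist_norm flip: scaleR_right_diff_distrib)
    also have "\<dots> \<le> dist z y" using t by (simp add: mult_left_le_one_le)
    also have "\<dots> < (1 - norm z) / 2" using y by (simp add: whitney_ball_def)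
    also have "\<dots> \<le> (1 - norm (t *\<^sub>R z)) / 2" using t by (simp add: mult_left_le_one_le)
    finally have "t *\<^sub>R y \<in> whitney_ball (t *\<^sub>R z)" by (simp add: whitney_ball_def)
    then show "\<rho> (t *\<^sub>R y) \<le> A * \<rho> (t *\<^sub>R z)"
      using z t by (intro harnack) (auto intro!: mult_norm_less_1)
  qed
  then show ?thesis by (simp add: radial_mean_def)
qed

text \<open>Removes the factor \<open>norm z\<close> in \<open>growth\<close>. Near the center the
  whole segment lies in the Whitney ball of \<open>0\<close>, and the summand
  \<open>\<rho> 0\<close> dominates; elsewhere the factor is at least \<open>1 / 2\<close>.\<close>

lemma radial_mean_le_growth:
  assumes z: "norm z < 1"
  shows "radial_mean z \<le> 2 * A * growth z"
proof (cases "norm z < 1 / 2")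
  case True
  have "radial_mean z \<le> integral {0..1} (\<lambda>t::real. A * \<rho> 0)"
    unfolding radial_mean_def
  proof (intro integral_le integrable_ray z)
    fix t :: real assume t: "t \<in> {0..1}"
    have "norm (t *\<^sub>R z) \<le> norm z" using t by (simp add: mult_left_le_one_le)
    then have "t *\<^sub>R z \<in> whitney_ball 0" using True by (simp add: whitney_ball_def)
    then show "\<rho> (t *\<^sub>R z) \<le> A * \<rho> 0" by (intro harnack) auto
  qed auto
  also have "\<dots> \<le> A * growth z" using growth_ge[OF z] A_ge_1 by simp
  also have "\<dots> \<le> 2 * A * growth z" using growth_pos[OF z] A_ge_1 by simp
  finally show ?thesis .
next
  case False
  have "radial_mean z \<le> 2 * (norm z * radial_mean z)"
    using mult_right_mono[of 1 "2 * norm z", OF _ radial_mean_nonneg[OF z]] False by simp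
  also have "\<dots> \<le> 2 * growth z" using pos[of 0] by (simp add: growth_def)
  also have "\<dots> \<le> A * (2 * growth z)"
    using mult_right_mono[of 1 A "2 * growth z"] growth_pos[OF z] A_ge_1 by simp
  finally show ?thesis by (simp add: ac_simps)
qed

text \<open>In the constant, \<open>1\<close> accounts for \<open>\<rho> 0 \<le> growth z\<close>;
  \<open>2 * A\<^sup>2\<close> is the factor \<open>A\<close> between the radial means times the
  factor \<open>2 * A\<close> of \<open>radial_mean_le_growth\<close>.\<close>

lemma growth_harnack:
  assumes z: "norm z < 1" and y: "y \<in> whitney_ball z" "norm y < 1"
  shows "growth y \<le> (1 + 2 * A\<^sup>2) * growth z"
proof -
  have "norm y * radial_mean y \<le> radial_mean y"
    using y radial_mean_nonneg by (intro mult_left_le_one_le) auto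
  also have "\<dots> \<le> A * radial_mean z" by (rule radial_mean_harnack[OF assms])
  also have "\<dots> \<le> A * (2 * A * growth z)"
    using A_ge_1 by (intro mult_left_mono radial_mean_le_growth z) auto
  finally show ?thesis
    using growth_ge[OF z] by (simp add: growth_def[of y] power2_eq_square algebra_simps)
qed

end

section \<open>Measure of thin cones\<close>

text \<open>
  The cone is covered by about \<open>1 / \<epsilon>\<close> balls of radius \<open>4 * \<epsilon>\<close> centered on one of its rays.
\<close>

lemma emeasure_thin_cone_le:
  fixes S :: "'a::euclidean_space set"
  assumes \<epsilon>: "0 < \<epsilon>" "\<epsilon> \<le> 1" and S: "S \<subseteq> ball 0 1" "0 \<notin> S"
    and thin: "\<And>x y. x \<in> S \<Longrightarrow> y \<in> S \<Longrightarrow> dist (x /\<^sub>R norm x) (y /\<^sub>R norm y) \<le> 2 * \<epsilon>"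
  shows "emeasure lborel S \<le> ennreal (2 * 4 ^ DIM('a) * unit_ball_vol DIM('a) * \<epsilon> ^ (DIM('a) - 1))"
proof (cases "S = {}")
  case False
  then obtain x0 where x0: "x0 \<in> S" by auto
  define w where "w = x0 /\<^sub>R norm x0"
  have "x0 \<noteq> 0" using x0 S by auto
  then have w: "norm w = 1" by (simp add: w_def)
  define K where "K = nat \<lfloor>1 / \<epsilon>\<rfloor>"
  have "S \<subseteq> (\<Union>k\<le>K. ball ((real k * \<epsilon>) *\<^sub>R w) (4 * \<epsilon>))"
  proof
    fix x assume x: "x \<in> S"
    then have x1: "norm x < 1" "x \<noteq> 0" using S by auto
    define k where "k = nat \<lfloor>norm x / \<epsilon>\<rfloor>"
    have "k \<le> K" unfolding k_def K_def
      using x1 \<epsilon> by (intro nat_mono floor_mono divide_right_mono) auto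
    have fl: "real k \<le> norm x / \<epsilon>" "norm x / \<epsilon> < real k + 1"
      unfolding k_def using \<epsilon> by (auto simp: of_nat_floor) 
    have "dist x (norm x *\<^sub>R w) = norm x * dist (x /\<^sub>R norm x) w"
    proof -
      have "x - norm x *\<^sub>R w = norm x *\<^sub>R (x /\<^sub>R norm x - w)"
        using x1 by (simp add: scaleR_right_diff_distrib)
      then show ?thesis by (simp add: dist_norm)
    qed
    also have "\<dots> \<le> 2 * \<epsilon>"
      using thin[OF x x0] x1 mult_left_le_one_le[of "dist (x /\<^sub>R norm x) w" "norm x"]
      unfolding w_def by simp
    finally have 1: "dist x (norm x *\<^sub>R w) \<le> 2 * \<epsilon>" .
    have "dist (norm x *\<^sub>R w) ((real k * \<epsilon>) *\<^sub>R w) = \<bar>norm x - real k * \<epsilon>\<bar>"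
      using w by (simp add: dist_norm flip: scaleR_left_diff_distrib)
    also have "\<dots> \<le> \<epsilon>"
      using fl \<epsilon> by (simp add: field_simps abs_le_iff)
    \<comment> \<open>Angular error at most \<open>2 * \<epsilon>\<close> plus rounding error at
      most \<open>\<epsilon>\<close>.\<close>
    finally have "dist x ((real k * \<epsilon>) *\<^sub>R w) < 4 * \<epsilon>"
      using 1 dist_triangle[of x "(real k * \<epsilon>) *\<^sub>R w" "norm x *\<^sub>R w"] \<epsilon> by simp
    then show "x \<in> (\<Union>k\<le>K. ball ((real k * \<epsilon>) *\<^sub>R w) (4 * \<epsilon>))"
      using \<open>k \<le> K\<close> by (auto simp: dist_commute)
  qed
  then have "emeasure lborel S \<le> emeasure lborel (\<Union>k\<le>K. ball ((real k * \<epsilon>) *\<^sub>R w) (4 * \<epsilon>))"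
    by (intro emeasure_mono) auto
  also have "\<dots> \<le> (\<Sum>k\<le>K. emeasure lborel (ball ((real k * \<epsilon>) *\<^sub>R w) (4 * \<epsilon>)))"
    by (intro emeasure_subadditive_finite) auto
  also have "\<dots> = (\<Sum>k\<le>K. ennreal (unit_ball_vol DIM('a) * (4 * \<epsilon>) ^ DIM('a)))"
    using \<epsilon> by (intro sum.cong emeasure_ball) auto
  also have "\<dots> = ennreal ((real K + 1) * (unit_ball_vol DIM('a) * (4 * \<epsilon>) ^ DIM('a)))"
    using \<epsilon> by (subst sum_ennreal) (auto simp: unit_ball_vol_nonneg)
  \<comment> \<open>The number of balls costs one power of \<open>\<epsilon>\<close>, which leaves
    the exponent \<open>DIM('a) - 1\<close>.\<close>
  also have "\<dots> \<le> ennreal ((2 / \<epsilon>) * (unit_ball_vol DIM('a) * (4 * \<epsilon>) ^ DIM('a)))"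
  proof (intro ennreal_leI mult_right_mono)
    have "real K \<le> 1 / \<epsilon>" unfolding K_def using \<epsilon> by (simp add: of_nat_floor)
    moreover have "1 \<le> 1 / \<epsilon>" using \<epsilon> by simp
    ultimately show "real K + 1 \<le> 2 / \<epsilon>" by simp
  qed (use \<epsilon> in auto)
  also have "(2 / \<epsilon>) * (unit_ball_vol DIM('a) * (4 * \<epsilon>) ^ DIM('a)) =
      2 * 4 ^ DIM('a) * unit_ball_vol DIM('a) * \<epsilon> ^ (DIM('a) - 1)"
  proof -
    have "\<epsilon> ^ DIM('a) = \<epsilon> * \<epsilon> ^ (DIM('a) - 1)"
      using DIM_positive[where 'a='a] by (metis power_eq_if not_gr_zero)
    then show ?thesis using \<epsilon> by (simp add: power_mult_distrib)
  qed
  finally show ?thesis .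
qed simp

section \<open>Energy of the logarithm of the growth\<close>

context harnack_density
begin

definition sublevel :: "real \<Rightarrow> (real ^ 'n) set" where
  "sublevel c = {y \<in> ball 0 1. growth y < c}"

text \<open>Along a radius, \<open>\<rho> / growth\<close> is the derivative of
  \<open>ln growth\<close>. The scaled indicator is the form in which continuity on an open set
  yields Borel measurability on the whole space.\<close>

definition log_energy :: "nat \<Rightarrow> real ^ 'n \<Rightarrow> ennreal" where
  "log_energy m y = ennreal (indicator (sublevel (\<rho> 0 * exp m)) y *\<^sub>R (\<rho> y / growth y) ^ CARD('n))"

lemma open_sublevel: "open (sublevel c)"
proof -
  have "sublevel c = ball 0 1 \<inter> growth -` {..<c}" by (auto simp: sublevel_def)
  then show ?thesis
    using continuous_open_preimage[OF continuous_on_growth open_ball open_lessThan] by metis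
qed

lemma sublevel_sub_ball: "sublevel c \<subseteq> ball 0 1"
  by (auto simp: sublevel_def)

lemma sets_sublevel [measurable]: "sublevel c \<in> sets borel"
  using open_sublevel by simp

lemma measurable_indicator_mult:
  assumes "continuous_on (ball 0 1) h"
  shows "(\<lambda>y. ennreal (indicator (sublevel c) y *\<^sub>R h y)) \<in> borel_measurable borel"
  by (rule measurable_compose[OF borel_measurable_continuous_on_indicator measurable_ennreal])
     (use continuous_on_subset[OF assms sublevel_sub_ball] in auto)

lemma log_energy_measurable [measurable]: "log_energy m \<in> borel_measurable borel"
  unfolding log_energy_def[abs_def]
  by (intro measurable_indicator_mult continuous_intros cont continuous_on_growth)
     (metis growth_pos mem_ball_0 less_irrefl)

text \<open>Raising \<open>m\<close> by one adds a layer where \<open>growth\<close> is at least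
  \<open>\<rho> 0 * exp m\<close>. The enlarged sublevel set lies in the \<open>\<rho>\<close>-ball
  about \<open>0\<close> of radius \<open>\<rho> 0 * exp (Suc m)\<close>, so VG bounds the energy of
  the layer by a constant.\<close>

lemma integral_log_energy_le:
  assumes VG: "satisfies_VG B \<rho>" and B0: "0 \<le> B"
  shows "(\<integral>\<^sup>+ y. log_energy m y \<partial>lborel) \<le> ennreal (m * (B * exp 1 ^ CARD('n)))"
proof (induction m)
  case 0
  \<comment> \<open>Since \<open>growth\<close> is at least \<open>\<rho> 0\<close>, the sublevel
    set for \<open>m = 0\<close> is empty.\<close>
  have "log_energy 0 y = 0" for y
    using growth_ge[of y] by (auto simp: log_energy_def indicator_def sublevel_def)
  then show ?case by simp
next
  case (Suc m)
  have \<rho>0: "0 < \<rho> 0" using pos by simp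
  let ?n = "CARD('n)" and ?c = "\<rho> 0 * exp (real m)" and ?S = "sublevel (\<rho> 0 * exp (real (Suc m)))"
  have c: "?c > 0" using \<rho>0 by simp
  have "(\<integral>\<^sup>+ y. log_energy (Suc m) y \<partial>lborel) \<le>
      (\<integral>\<^sup>+ y. log_energy m y + ennreal (1 / ?c ^ ?n) * ennreal (indicator ?S y *\<^sub>R \<rho> y ^ ?n) \<partial>lborel)"
  proof (intro nn_integral_mono)
    fix y :: "real ^ 'n"
    consider "y \<in> sublevel ?c" | "y \<notin> ?S" | "y \<in> ?S" "y \<notin> sublevel ?c" by blast
    then show "log_energy (Suc m) y \<le>
        log_energy m y + ennreal (1 / ?c ^ ?n) * ennreal (indicator ?S y *\<^sub>R \<rho> y ^ ?n)"
    proof cases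
      case 1
      then have "log_energy (Suc m) y \<le> log_energy m y"
        unfolding log_energy_def
        using pos growth_pos by (intro ennreal_leI) (auto simp: indicator_def sublevel_def less_imp_le)
      then show ?thesis by (simp add: add_increasing2)
    next
      case 3
      then have y: "norm y < 1" "?c \<le> growth y" by (auto simp: sublevel_def)
      have "(\<rho> y / growth y) ^ ?n \<le> (\<rho> y / ?c) ^ ?n"
        using y c pos[OF y(1)] by (intro power_mono divide_left_mono) auto
      then have "log_energy (Suc m) y \<le> ennreal ((\<rho> y / ?c) ^ ?n)"
        unfolding log_energy_def using 3 by (intro ennreal_leI) auto
      also have "\<dots> = ennreal (1 / ?c ^ ?n) * ennreal (indicator ?S y *\<^sub>R \<rho> y ^ ?n)"
        using 3 c pos[OF y(1)] by (simp add: power_divide less_imp_le flip: ennreal_mult)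
      finally show ?thesis by (simp add: add_increasing)
    qed (simp add: log_energy_def)
  qed
  also have "\<dots> = (\<integral>\<^sup>+ y. log_energy m y \<partial>lborel) +
      ennreal (1 / ?c ^ ?n) * (\<integral>\<^sup>+ y. ennreal (indicator ?S y *\<^sub>R \<rho> y ^ ?n) \<partial>lborel)"
    using measurable_indicator_mult[of "\<lambda>y. \<rho> y ^ ?n" "\<rho> 0 * exp (real (Suc m))"]
    by (simp add: nn_integral_add nn_integral_cmult continuous_on_power cont
        del: of_nat_Suc real_scaleR_def)
  also have "(\<integral>\<^sup>+ y. ennreal (indicator ?S y *\<^sub>R \<rho> y ^ ?n) \<partial>lborel) \<le>
      (\<integral>\<^sup>+ y \<in> rho_ball \<rho> 0 (\<rho> 0 * exp (real (Suc m))). ennreal (\<rho> y ^ ?n) \<partial>lborel)"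
  proof (intro nn_integral_mono)
    fix y :: "real ^ 'n"
    have "y \<in> rho_ball \<rho> 0 (\<rho> 0 * exp (real (Suc m)))" if "y \<in> ?S"
      using that rho_dist_0_le[of y] \<rho>0 by (simp add: sublevel_def rho_ball_def growth_def)
    then show "ennreal (indicator ?S y *\<^sub>R \<rho> y ^ ?n) \<le>
        ennreal (\<rho> y ^ ?n) * indicator (rho_ball \<rho> 0 (\<rho> 0 * exp (real (Suc m)))) y"
      by (auto simp: indicator_def)
  qed
  also have "\<dots> \<le> ennreal (B * (\<rho> 0 * exp (real (Suc m))) ^ ?n)"
    using VG \<rho>0 unfolding satisfies_VG_def by simp
  \<comment> \<open>The powers of \<open>\<rho> 0 * exp m\<close> cancel, so each layer costs the
    same, whatever \<open>\<rho> 0\<close> is.\<close>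
  also have "ennreal (1 / ?c ^ ?n) * \<dots> = ennreal (B * exp 1 ^ ?n)"
    using c B0 \<rho>0
    by (simp add: exp_add power_mult_distrib flip: ennreal_mult)
  finally have "(\<integral>\<^sup>+ y. log_energy (Suc m) y \<partial>lborel)
      \<le> (\<integral>\<^sup>+ y. log_energy m y \<partial>lborel) + ennreal (B * exp 1 ^ ?n)"
    by (simp add: add_left_mono mult_left_mono)
  also have "\<dots> \<le> ennreal (m * (B * exp 1 ^ CARD('n))) + ennreal (B * exp 1 ^ ?n)"
    by (intro add_right_mono Suc.IH)
  also have "\<dots> = ennreal (Suc m * (B * exp 1 ^ CARD('n)))"
    using B0 by (simp add: algebra_simps flip: ennreal_plus)
  finally show ?case .
qed

section \<open>Points on a radius, shells and local energies\<close>

text \<open>Only the direction of \<open>x\<close> matters. Letting \<open>x\<close> range over the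
  ball replaces integrals over directions by Lebesgue integrals. For \<open>j = 0\<close> or
  \<open>x = 0\<close> the value is the center.\<close>

definition ray_point :: "nat \<Rightarrow> real ^ 'n \<Rightarrow> real ^ 'n" where
  "ray_point j x = (1 - (3 / 4) ^ j) *\<^sub>R (x /\<^sub>R norm x)"

text \<open>The margins \<open>7 / 8\<close> and \<open>9 / 8\<close> leave room for balls of radius
  \<open>(3 / 4) ^ j / 8\<close> about points at distance \<open>(3 / 4) ^ j\<close> from the
  sphere.\<close>

definition shell :: "nat \<Rightarrow> (real ^ 'n) set" where
  "shell j = {y. 7 / 8 * (3 / 4) ^ j < 1 - norm y \<and> 1 - norm y < 9 / 8 * (3 / 4) ^ j}"

definition local_energy :: "nat \<Rightarrow> nat \<Rightarrow> real ^ 'n \<Rightarrow> ennreal" where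
  "local_energy m j x = (\<integral>\<^sup>+ y \<in> ball (ray_point j x) ((3 / 4) ^ j / 8). log_energy m y \<partial>lborel)"

definition shell_energy :: "nat \<Rightarrow> nat \<Rightarrow> ennreal" where
  "shell_energy m j = (\<integral>\<^sup>+ y \<in> shell j. log_energy m y \<partial>lborel)"

lemma q_pow: "0 < (3 / 4 :: real) ^ j" "(3 / 4 :: real) ^ j \<le> 1"
  by (auto intro: power_le_one)

lemma norm_ray_point: "x \<noteq> 0 \<Longrightarrow> norm (ray_point j x) = 1 - (3 / 4) ^ j"
  using q_pow[of j] by (simp add: ray_point_def)

lemma ball_subset_shell: "x \<noteq> 0 \<Longrightarrow> ball (ray_point j x) ((3 / 4) ^ j / 8) \<subseteq> shell j"
proof
  fix y assume "x \<noteq> 0" "y \<in> ball (ray_point j x) ((3 / 4) ^ j / 8)"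
  then have "\<bar>norm (ray_point j x) - norm y\<bar> < (3 / 4) ^ j / 8"
    using norm_triangle_ineq3[of "ray_point j x" y] by (simp add: dist_norm)
  then show "y \<in> shell j"
    unfolding norm_ray_point[OF \<open>x \<noteq> 0\<close>] shell_def abs_less_iff mem_Collect_eq by linarith
qed

lemma sets_shell [measurable]: "shell j \<in> sets borel"
  unfolding shell_def by measurable

text \<open>Consecutive shells are separated because
  \<open>9 / 8 * (3 / 4) = 27 / 32 < 7 / 8\<close>.\<close>

lemma disjoint_shells: "disjoint_family shell"
proof -
  have "shell i \<inter> shell j = {}" if "i < j" for i j
  proof -
    have "(3 / 4 :: real) ^ j \<le> (3 / 4) ^ Suc i"
      using that by (intro power_decreasing) auto
    then have "(3 / 4 :: real) ^ j \<le> 3 / 4 * (3 / 4) ^ i" by simp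
    then show ?thesis using q_pow(1)[of i]
      unfolding shell_def disjoint_iff mem_Collect_eq by (intro allI impI notI) linarith
  qed
  then show ?thesis
    unfolding disjoint_family_on_def by (metis Int_commute nat_neq_iff)
qed

lemma sum_shell_energy_le:
  "finite I \<Longrightarrow> (\<Sum>j\<in>I. shell_energy m j) \<le> (\<integral>\<^sup>+ y. log_energy m y \<partial>lborel)"
proof -
  assume I: "finite I"
  have "(\<Sum>j\<in>I. shell_energy m j) = (\<integral>\<^sup>+ y. (\<Sum>j\<in>I. log_energy m y * indicator (shell j) y) \<partial>lborel)"
    unfolding shell_energy_def by (rule nn_integral_sum[symmetric]) measurable
  also have "\<dots> = (\<integral>\<^sup>+ y. log_energy m y * indicator (\<Union>j\<in>I. shell j) y \<partial>lborel)"
    by (intro nn_integral_cong)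
       (simp add: indicator_UN_disjoint[OF I] disjoint_family_on_mono[OF subset_UNIV disjoint_shells] sum_distrib_left)
  also have "\<dots> \<le> (\<integral>\<^sup>+ y. log_energy m y \<partial>lborel)"
    by (intro nn_integral_mono) (simp add: indicator_def)
  finally show ?thesis .
qed

lemma local_energy_le: "x \<noteq> 0 \<Longrightarrow> local_energy m j x \<le> shell_energy m j"
  unfolding local_energy_def shell_energy_def
  using ball_subset_shell[of x j]
  by (intro nn_integral_mono) (auto simp: indicator_def simp del: mem_ball)

lemma shell_subset_ball:
  "shell j \<subseteq> ball 0 1"
proof
  fix y :: "real ^ 'n" assume "y \<in> shell j"
  then have "0 < 1 - norm y" using q_pow(1)[of j] unfolding shell_def mem_Collect_eq by linarith
  then show "y \<in> ball 0 1" by simp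
qed

section \<open>Increments of the logarithm of the growth\<close>

text \<open>Not the increment of \<open>ln growth\<close> itself but the bound for it that
  \<open>growth_step\<close> gives with \<open>1 - s = (3 / 4) ^ j\<close>.\<close>

definition radial_oscillation :: "nat \<Rightarrow> real ^ 'n \<Rightarrow> real" where
  "radial_oscillation j x = A / 4 * \<rho> (ray_point j x) * (3 / 4) ^ j / growth (ray_point j x)"

lemma norm_ray_point_less: "norm (ray_point j x) < 1"
proof (cases "x = 0")
  case False
  then show ?thesis using norm_ray_point[OF False, of j] q_pow(1)[of j] by linarith
qed (simp add: ray_point_def)

lemma radial_oscillation_nonneg: "0 \<le> radial_oscillation j x"
  using A_ge_1 pos[OF norm_ray_point_less[of j x]] growth_pos[OF norm_ray_point_less[of j x]]
  by (simp add: radial_oscillation_def)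

text \<open>By Harnack, \<open>\<rho> / growth\<close> on the small ball is comparable to its value
  at the center. The shift \<open>\<kappa>\<close> absorbs the Harnack factor of
  \<open>growth\<close>, so that the whole ball lies in the sublevel set used by the energy.\<close>

lemma radial_oscillation_power_le:
  assumes x: "x \<noteq> 0" and low: "growth (ray_point j x) \<le> \<rho> 0 * exp M"
    and \<kappa>: "1 + 2 * A\<^sup>2 < exp (real \<kappa>)"
  shows "ennreal (radial_oscillation j x ^ CARD('n)) \<le>
    ennreal ((2 * A\<^sup>2 * (1 + 2 * A\<^sup>2)) ^ CARD('n) / unit_ball_vol CARD('n)) * local_energy (M + \<kappa>) j x"
proof -
  let ?n = "CARD('n)" and ?K = "1 + 2 * A\<^sup>2" and ?v = "unit_ball_vol (real CARD('n))"
  define z where "z = ray_point j x"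
  define r where "r = (3 / 4 :: real) ^ j / 8"
  \<comment> \<open>Lower bound for \<open>\<rho> / growth\<close> on the ball:
    \<open>\<rho>\<close> loses the factor \<open>A\<close>, \<open>growth\<close> gains the factor
    \<open>?K\<close>.\<close>
  define b where "b = \<rho> z / (A * ?K * growth z)"
  have z: "norm z < 1" by (simp add: z_def norm_ray_point_less)
  have K: "?K > 0" by (simp add: add_pos_nonneg)
  have gz: "0 < growth z" and rz: "0 < \<rho> z" using z growth_pos pos by auto
  have b0: "0 \<le> b" using A_ge_1 K gz rz by (simp add: b_def)
  have r0: "0 < r" by (simp add: r_def)
  have v: "0 < ?v" by simp
  have "ennreal (b ^ ?n) * indicator (ball z r) y \<le> log_energy (M + \<kappa>) y * indicator (ball z r) y" for y
  proof (cases "y \<in> ball z r")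
    case True
    then have "y \<in> shell j" using ball_subset_shell[OF x, of j] by (auto simp: z_def r_def)
    then have y: "norm y < 1" using shell_subset_ball[of j] by auto
    have "1 - norm z = 8 * r" using norm_ray_point[OF x, of j] by (simp add: z_def r_def)
    then have "(1 - norm z) / 2 = 4 * r" by simp
    moreover have "dist z y < r" using True by simp
    ultimately have wy: "y \<in> whitney_ball z"
      using r0 by (simp add: whitney_ball_def)
    have g: "growth y \<le> ?K * growth z" by (rule growth_harnack[OF z wy y])
    also have "\<dots> \<le> ?K * (\<rho> 0 * exp M)" using low K by (simp add: z_def)
    also have "\<dots> < exp \<kappa> * (\<rho> 0 * exp M)" using \<kappa> pos[of 0] by (intro mult_strict_right_mono) auto
    also have "\<dots> = \<rho> 0 * exp (real (M + \<kappa>))" by (simp add: exp_add)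
    finally have sub: "y \<in> sublevel (\<rho> 0 * exp (real (M + \<kappa>)))" using y by (simp add: sublevel_def)
    have "b = (\<rho> z / A) / (?K * growth z)" by (simp add: b_def)
    also have "\<dots> \<le> \<rho> y / growth y"
      using harnack(2)[OF z wy] A_ge_1 g growth_pos[OF y] pos[OF y]
      by (intro frac_le) (auto simp: divide_le_eq mult.commute)
    finally have "b ^ ?n \<le> (\<rho> y / growth y) ^ ?n" using b0 by (intro power_mono)
    then show ?thesis using True sub by (simp add: log_energy_def ennreal_leI del: of_nat_add)
  qed simp
  then have lower: "(\<integral>\<^sup>+ y. ennreal (b ^ ?n) * indicator (ball z r) y \<partial>lborel) \<le> local_energy (M + \<kappa>) j x"
    unfolding local_energy_def z_def r_def by (intro nn_integral_mono)
  have value_b: "(\<integral>\<^sup>+ y. ennreal (b ^ ?n) * indicator (ball z r) y \<partial>lborel) =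
      ennreal (b ^ ?n * (?v * r ^ ?n))"
    using r0 b0 by (subst nn_integral_cmult_indicator) (auto simp: emeasure_ball ennreal_mult)
  \<comment> \<open>As \<open>(3 / 4) ^ j = 8 * r\<close>, the oscillation is a fixed multiple of
    \<open>b * r\<close>, whose power is the energy of the constant \<open>b\<close> on the ball up
    to the factor \<open>?v\<close>.\<close>
  have "A / 4 * p * q / g = (2 * A\<^sup>2 * k) * (p / (A * k * g)) * (q / 8)" if "0 < k" "0 < g"
    for p q g k :: real
    using A_ge_1 that by (simp add: power2_eq_square field_simps)
  from this[OF K gz] have "radial_oscillation j x = (2 * A\<^sup>2 * ?K) * b * r"
    unfolding radial_oscillation_def b_def r_def z_def .
  then have "radial_oscillation j x ^ ?n = (2 * A\<^sup>2 * ?K) ^ ?n * b ^ ?n * r ^ ?n"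
    by (simp only: power_mult_distrib)
  moreover have "k * p * q = k / ?v * (p * (?v * q))" for k p q
    using less_imp_neq[OF v, symmetric] by simp
  ultimately have osc: "radial_oscillation j x ^ ?n = (2 * A\<^sup>2 * ?K) ^ ?n / ?v * (b ^ ?n * (?v * r ^ ?n))"
    by metis
  have "ennreal (radial_oscillation j x ^ ?n) =
      ennreal ((2 * A\<^sup>2 * ?K) ^ ?n / ?v) * ennreal (b ^ ?n * (?v * r ^ ?n))"
    unfolding osc by (intro ennreal_mult' divide_nonneg_pos v zero_le_power) simp
  also have "\<dots> \<le> ennreal ((2 * A\<^sup>2 * ?K) ^ ?n / ?v) * local_energy (M + \<kappa>) j x"
    using lower unfolding value_b by (rule mult_left_mono) simp
  finally show ?thesis .
qed

lemma growth_ray_point_Suc: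
  assumes x: "x \<noteq> 0"
  shows "growth (ray_point (Suc j) x) \<le> growth (ray_point j x) * (1 + radial_oscillation j x)"
proof -
  have "growth (ray_point (Suc j) x) \<le> growth (ray_point j x) +
      A * \<rho> (ray_point j x) * ((1 - (1 - (3 / 4) ^ j)) / 4)"
    unfolding ray_point_def by (rule growth_step) (use x q_pow[of j] in auto)
  also have "\<dots> = growth (ray_point j x) * (1 + radial_oscillation j x)"
    using growth_pos[OF norm_ray_point_less[of j x]]
    by (simp add: radial_oscillation_def distrib_left)
  finally show ?thesis .
qed

text \<open>Only terms below the level \<open>M\<close> are controlled by energy, hence the
  truncation. It is harmless: when the level is exceeded at an index, the terms before that index
  already sum to at least \<open>M\<close>.\<close>

lemma sum_radial_oscillation_ge:
  assumes x: "x \<noteq> 0"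
  shows "min (ln (growth (ray_point N x) / \<rho> 0)) M \<le>
    (\<Sum>j<N. if growth (ray_point j x) \<le> \<rho> 0 * exp M then radial_oscillation j x else 0)"
proof (induction N)
  case 0
  have "ray_point 0 x = 0" by (simp add: ray_point_def)
  then show ?case using pos[of 0] by (simp add: growth_0)
next
  case (Suc N)
  let ?g = "\<lambda>j. growth (ray_point j x)"
  have g: "0 < ?g j" for j by (rule growth_pos[OF norm_ray_point_less])
  have \<rho>0: "0 < \<rho> 0" using pos by simp
  show ?case
  proof (cases "?g N \<le> \<rho> 0 * exp M")
    case True
    have "?g (Suc N) / \<rho> 0 \<le> (?g N / \<rho> 0) * (1 + radial_oscillation N x)"
      using growth_ray_point_Suc[OF x, of N] \<rho>0 by (simp add: field_simps)
    then have "ln (?g (Suc N) / \<rho> 0) \<le> ln ((?g N / \<rho> 0) * (1 + radial_oscillation N x))"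
      using g \<rho>0 radial_oscillation_nonneg[of N x] by (subst ln_le_cancel_iff) auto
    also have "\<dots> = ln (?g N / \<rho> 0) + ln (1 + radial_oscillation N x)"
      using g[of N] \<rho>0 radial_oscillation_nonneg[of N x] by (intro ln_mult_pos) auto
    also have "\<dots> \<le> ln (?g N / \<rho> 0) + radial_oscillation N x"
      using radial_oscillation_nonneg[of N x] by (simp add: ln_add_one_self_le_self)
    finally show ?thesis using Suc.IH True radial_oscillation_nonneg[of N x] by auto
  next
    case False
    then have "exp M < ?g N / \<rho> 0" using \<rho>0 by (simp add: field_simps)
    then have "M < ln (?g N / \<rho> 0)" using ln_less_cancel_iff[of "exp M" "?g N / \<rho> 0"] g[of N] \<rho>0 by simp
    then show ?thesis using Suc.IH False by auto
  qed
qed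

section \<open>Averaging local energies over directions\<close>

lemma ray_point_measurable [measurable]: "ray_point j \<in> borel_measurable borel"
  unfolding ray_point_def[abs_def] by measurable

text \<open>After exchanging the integrals, each \<open>y\<close> in the shell is weighted by the
  volume of \<open>S y\<close>, a cone of angular width comparable to \<open>(3 / 4) ^ j\<close>;
  other \<open>y\<close> have empty \<open>S y\<close>.\<close>

lemma integral_local_energy_le:
  "(\<integral>\<^sup>+ x \<in> ball 0 1 - {0}. local_energy m j x \<partial>lborel) \<le>
    ennreal (2 * 4 ^ CARD('n) * unit_ball_vol CARD('n) * ((3 / 4) ^ j) ^ (CARD('n) - 1)) * shell_energy m j"
    (is "_ \<le> ?C * _")
proof -
  let ?r = "(3 / 4 :: real) ^ j / 8"
  define S where "S y = {x \<in> ball 0 1 - {0}. dist (ray_point j x) y < ?r}" for y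
  have S_sets [measurable]: "S y \<in> sets borel" for y
    unfolding S_def by measurable
  have S_le: "emeasure lborel (S y) * indicator (shell j) y \<le> ?C * indicator (shell j) y"
    and S_empty: "y \<notin> shell j \<Longrightarrow> S y = {}" for y
  proof -
    have "y \<in> shell j" if "x \<in> S y" for x
      using that unfolding S_def by (intro subsetD[OF ball_subset_shell[of x j]]) simp_all
    then show "S y = {}" if "y \<notin> shell j" using that by blast
    have "emeasure lborel (S y) \<le> ennreal (2 * 4 ^ DIM(real ^ 'n) * unit_ball_vol DIM(real ^ 'n) *
        ((3 / 4) ^ j) ^ (DIM(real ^ 'n) - 1))"
    proof (rule emeasure_thin_cone_le[OF q_pow])
      fix x x' assume xx: "x \<in> S y" "x' \<in> S y"
      let ?u = "x /\<^sub>R norm x" and ?u' = "x' /\<^sub>R norm x'"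
      have n1: "norm ?u = 1" "norm ?u' = 1" using xx by (auto simp: S_def)
      show "dist ?u ?u' \<le> 2 * (3 / 4) ^ j"
      proof (cases j)
        case 0
        then show ?thesis using norm_triangle_ineq4[of ?u ?u'] n1 by (simp add: dist_norm)
      next
        case (Suc i)
        \<comment> \<open>For \<open>j \<ge> 1\<close> the ray points have norm at least
          \<open>1 / 4\<close>, so directions differ by at most four times the distance of the ray
          points. For \<open>j = 0\<close> the bound \<open>2\<close> on distances of unit vectors
          was enough.\<close>
        have t: "1 / 4 \<le> 1 - (3 / 4 :: real) ^ j" using q_pow(2)[of i] Suc by simp
        have "1 / 4 * dist ?u ?u' \<le> (1 - (3 / 4) ^ j) * dist ?u ?u'"
          by (intro mult_right_mono t) simp
        also have "\<dots> = norm ((1 - (3 / 4) ^ j) *\<^sub>R (?u - ?u'))"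
          using t by (simp only: norm_scaleR dist_norm)
        also have "\<dots> = dist (ray_point j x) (ray_point j x')"
          by (simp only: ray_point_def dist_norm scaleR_right_diff_distrib)
        also have "\<dots> < ?r + ?r"
          using xx dist_triangle[of "ray_point j x" "ray_point j x'" y]
          by (simp add: S_def dist_commute)
        finally have "dist ?u ?u' < (3 / 4) ^ j" by simp
        then show ?thesis using q_pow(1)[of j] by linarith
      qed
    qed (auto simp: S_def)
    then show "emeasure lborel (S y) * indicator (shell j) y \<le> ?C * indicator (shell j) y"
      by (intro mult_right_mono) auto
  qed
  have "(\<integral>\<^sup>+ x \<in> ball 0 1 - {0}. local_energy m j x \<partial>lborel) =
      (\<integral>\<^sup>+ x. (\<integral>\<^sup>+ y. (if norm x < 1 \<and> x \<noteq> 0 \<and> dist (ray_point j x) y < ?r then log_energy m y else 0) \<partial>lborel) \<partial>lborel)"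
    unfolding local_energy_def
    by (intro nn_integral_cong) (auto simp: indicator_def intro!: nn_integral_cong)
  also have "\<dots> = (\<integral>\<^sup>+ y. (\<integral>\<^sup>+ x. (if norm x < 1 \<and> x \<noteq> 0 \<and> dist (ray_point j x) y < ?r then log_energy m y else 0) \<partial>lborel) \<partial>lborel)"
    by (rule lborel_pair.Fubini') measurable
  also have "\<dots> = (\<integral>\<^sup>+ y. (\<integral>\<^sup>+ x. log_energy m y * indicator (S y) x \<partial>lborel) \<partial>lborel)"
    by (intro nn_integral_cong) (auto simp: indicator_def S_def)
  also have "\<dots> = (\<integral>\<^sup>+ y. log_energy m y * emeasure lborel (S y) \<partial>lborel)"
    by (intro nn_integral_cong nn_integral_cmult_indicator) simp
  also have "\<dots> \<le> (\<integral>\<^sup>+ y. ?C * (log_energy m y * indicator (shell j) y) \<partial>lborel)"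
  proof (intro nn_integral_mono)
    fix y
    show "log_energy m y * emeasure lborel (S y) \<le> ?C * (log_energy m y * indicator (shell j) y)"
      using S_le[of y] S_empty[of y] mult_left_mono[of "emeasure lborel (S y)" ?C "log_energy m y"]
      by (cases "y \<in> shell j") (auto simp: mult.commute)
  qed
  also have "\<dots> = ?C * shell_energy m j"
    unfolding shell_energy_def by (rule nn_integral_cmult) measurable
  finally show ?thesis .
qed

end

section \<open>Distribution of the growth and the main estimate\<close>

text \<open>Where \<open>a > \<theta>\<close>, multiplying \<open>a\<close> by
  \<open>(a / \<theta>) ^ (n - 1) \<ge> 1\<close> only enlarges it.\<close>

lemma young_power:
  fixes a \<theta> :: real
  assumes "0 \<le> a" "0 < \<theta>" "1 \<le> n"
  shows "a \<le> \<theta> + (1 / \<theta>) ^ (n - 1) * a ^ n"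
proof (cases "a \<le> \<theta>")
  case False
  have "a * 1 \<le> a * (a / \<theta>) ^ (n - 1)"
    using False assms by (intro mult_left_mono one_le_power) auto
  also have "\<dots> = (1 / \<theta>) ^ (n - 1) * a ^ n"
    using assms by (cases n) (auto simp: power_divide)
  finally show ?thesis using assms by simp
qed (use assms in \<open>simp add: add_increasing2\<close>)

text \<open>Truncated subtraction makes the first \<open>J\<close> weights equal to 1; the remaining
  geometric series sums to at most 4.\<close>

lemma sum_truncated_geometric_le: "(\<Sum>j<N. (3 / 4 :: real) ^ (j - J)) \<le> J + 4"
proof -
  have "(\<Sum>j<N. (3 / 4 :: real) ^ (j - J)) = min N J + 4 * (1 - (3 / 4) ^ (N - J))"
  proof (induction N)
    case (Suc N)
    then show ?case by (cases "N < J") (simp_all add: Suc_diff_le)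
  qed simp
  also have "\<dots> \<le> J + 4" by (simp add: min_def)
  finally show ?thesis .
qed

context harnack_density
begin

text \<open>\<open>CARD('n)\<close> times its volume is the surface measure of the corresponding set
  of directions.\<close>

definition superlevel_cone :: "nat \<Rightarrow> real \<Rightarrow> (real ^ 'n) set" where
  "superlevel_cone N c = {x \<in> ball 0 1 - {0}. c < growth (ray_point N x)}"

lemma sets_superlevel_cone [measurable]: "superlevel_cone N c \<in> sets borel"
proof -
  have "continuous_on (ball 0 1 - {0}) (ray_point N)"
    unfolding ray_point_def[abs_def] by (intro continuous_intros) auto
  then have "continuous_on (ball 0 1 - {0}) (\<lambda>x. growth (ray_point N x))"
    by (rule continuous_on_compose2[OF continuous_on_growth]) (use norm_ray_point_less in auto)
  then have "open ((ball 0 1 - {0}) \<inter> (\<lambda>x. growth (ray_point N x)) -` {c<..})"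
    by (rule continuous_open_preimage) auto
  moreover have "superlevel_cone N c = (ball 0 1 - {0}) \<inter> (\<lambda>x. growth (ray_point N x)) -` {c<..}"
    by (auto simp: superlevel_cone_def)
  ultimately show ?thesis by simp
qed

lemma local_energy_measurable [measurable]: "local_energy m j \<in> borel_measurable borel"
proof -
  have "local_energy m j = (\<lambda>x. \<integral>\<^sup>+ y. (if dist (ray_point j x) y < (3 / 4) ^ j / 8 then log_energy m y else 0) \<partial>lborel)"
    unfolding local_energy_def[abs_def]
    by (intro ext nn_integral_cong) (auto simp: indicator_def)
  also have "\<dots> \<in> borel_measurable borel" by measurable
  finally show ?thesis .
qed

text \<open>With \<open>T\<close> fixed and \<open>J\<close> free, this is a power-type decay of the
  distribution of \<open>growth\<close>, uniform in \<open>N\<close>.\<close>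

lemma emeasure_superlevel_cone_le:
  assumes n: "2 \<le> CARD('n)" and VG: "satisfies_VG B \<rho>" and B: "0 \<le> B"
    and \<kappa>: "1 + 2 * A\<^sup>2 < exp (real \<kappa>)"
    and C1: "C1 = (2 * A\<^sup>2 * (1 + 2 * A\<^sup>2)) ^ CARD('n) / unit_ball_vol CARD('n)"
    and T: "1 \<le> T" "4 * C1 * ((1 + real \<kappa>) * (B * exp 1 ^ CARD('n))) \<le> real T"
  shows "emeasure lborel (superlevel_cone N (\<rho> 0 * exp (real (2 * T * (J + 4))))) \<le>
    ennreal (2 * 4 ^ CARD('n) * unit_ball_vol CARD('n) * (3 / 4) ^ J)"
proof -
  let ?n = "CARD('n)"
  \<comment> \<open>Chosen so that the linear terms \<open>T * (3 / 4) ^ (j - J)\<close> of Young's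
    inequality sum to at most \<open>M / 2\<close>.\<close>
  define M where "M = 2 * T * (J + 4)"
  define m where "m = M + \<kappa>"
  define E where "E = superlevel_cone N (\<rho> 0 * exp (real M))"
  define C3 where "C3 = 2 * 4 ^ ?n * unit_ball_vol ?n"
  \<comment> \<open>The coefficient in \<open>young_power\<close> for
    \<open>\<theta> = T * (3 / 4) ^ (j - J)\<close>.\<close>
  define c where "c j = (1 / (real T * (3 / 4) ^ (j - J))) ^ (?n - 1)" for j
  have C1_nonneg: "0 \<le> C1" unfolding C1 by (intro divide_nonneg_nonneg) auto
  have C3_nonneg: "0 \<le> C3" unfolding C3_def by simp
  have T0: "0 < real T" using T by simp
  have c0: "0 \<le> c j" for j by (simp add: c_def)
  have "1 \<le> M" using T(1) by (simp add: M_def Suc_le_eq)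
  then have M1: "1 \<le> real M" by simp
  \<comment> \<open>The condition on \<open>T\<close> serves this bound:
    \<open>m \<le> M * (1 + \<kappa>)\<close> because \<open>M \<ge> 1\<close>, so the energy is
    linear in \<open>M\<close>, and dividing by \<open>T\<close> leaves at most
    \<open>M / 4\<close>.\<close>
  have energy: "ennreal (C1 / T) * (\<integral>\<^sup>+ y. log_energy m y \<partial>lborel) \<le> ennreal (M / 4)"
  proof -
    let ?b = "B * exp 1 ^ ?n"
    have b: "0 \<le> ?b" using B by simp
    have "ennreal (C1 / T) * (\<integral>\<^sup>+ y. log_energy m y \<partial>lborel) \<le> ennreal (C1 / T) * ennreal (m * ?b)"
      by (intro mult_left_mono integral_log_energy_le VG B) auto
    also have "\<dots> = ennreal (C1 / T * (m * ?b))"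
      using C1_nonneg B by (intro ennreal_mult[symmetric]) auto
    also have "\<dots> \<le> ennreal (M / 4)"
    proof (rule ennreal_leI)
      have "real m \<le> real M * (1 + real \<kappa>)" using mult_right_mono[OF M1, of "real \<kappa>"] by (simp add: m_def algebra_simps)
      then have "4 * C1 * (m * ?b) \<le> 4 * C1 * (real M * (1 + real \<kappa>) * ?b)"
        using b C1_nonneg by (intro mult_left_mono mult_right_mono) auto
      also have "\<dots> = real M * (4 * C1 * ((1 + real \<kappa>) * ?b))" by (simp only: mult_ac)
      also have "\<dots> \<le> real M * real T" by (intro mult_left_mono T) auto
      finally show "C1 / T * (m * ?b) \<le> M / 4" using T0 by (simp add: field_simps)
    qed
    finally show ?thesis .
  qed
  define R where "R x = (\<Sum>j\<in>{J..<N}. ennreal (c j * C1) * local_energy m j x)" for x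
  have R_meas [measurable]: "R \<in> borel_measurable borel" unfolding R_def[abs_def] by measurable
  have lower: "ennreal (M / 4) \<le> R x" if x: "x \<in> E" for x
  proof -
    have x0: "x \<noteq> 0" and big: "\<rho> 0 * exp (real M) < growth (ray_point N x)"
      using x by (auto simp: E_def superlevel_cone_def)
    define a where "a j = (if growth (ray_point j x) \<le> \<rho> 0 * exp (real M) then radial_oscillation j x else 0)" for j
    have a0: "0 \<le> a j" for j by (simp add: a_def radial_oscillation_nonneg)
    have "exp M < growth (ray_point N x) / \<rho> 0" using big pos[of 0] by (simp add: field_simps)
    then have "M < ln (growth (ray_point N x) / \<rho> 0)"
      using ln_less_cancel_iff[of "exp M" "growth (ray_point N x) / \<rho> 0"]
      by (simp add: order.strict_trans[OF exp_gt_zero])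
    then have "M \<le> (\<Sum>j<N. a j)"
      using sum_radial_oscillation_ge[OF x0, of N M] by (simp add: a_def)
    also have "\<dots> \<le> (\<Sum>j<N. T * (3 / 4) ^ (j - J) + c j * a j ^ ?n)"
      unfolding c_def using a0 T0 n by (intro sum_mono young_power) auto
    also have "\<dots> = T * (\<Sum>j<N. (3 / 4) ^ (j - J)) + (\<Sum>j<N. c j * a j ^ ?n)"
      by (simp add: sum.distrib sum_distrib_left)
    also have "T * (\<Sum>j<N. (3 / 4 :: real) ^ (j - J)) \<le> real T * real (J + 4)"
      using sum_truncated_geometric_le[of J N] by (intro mult_left_mono) auto
    also have "real T * real (J + 4) = real M / 2" by (simp add: M_def)
    finally have "real M / 2 \<le> (\<Sum>j<N. c j * a j ^ ?n)" by simp
    then have "ennreal (M / 2) \<le> ennreal (\<Sum>j<N. c j * a j ^ ?n)" by (rule ennreal_leI)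
    also have "\<dots> = (\<Sum>j<N. ennreal (c j * a j ^ ?n))"
      using a0 c0 by (intro sum_ennreal[symmetric]) auto
    also have "\<dots> \<le> (\<Sum>j<N. ennreal (c j * C1) * local_energy m j x)"
    proof (rule sum_mono)
      fix j
      have "ennreal (a j ^ ?n) \<le> ennreal C1 * local_energy m j x"
        using radial_oscillation_power_le[OF x0 _ \<kappa>, of j M] n
        by (auto simp: a_def C1 m_def zero_power)
      then show "ennreal (c j * a j ^ ?n) \<le> ennreal (c j * C1) * local_energy m j x"
        using c0 C1_nonneg a0 by (simp add: ennreal_mult mult.assoc mult_left_mono)
    qed
    also have "\<dots> \<le> (\<Sum>j\<in>{..<J} \<union> {J..<N}. ennreal (c j * C1) * local_energy m j x)"
      by (intro sum_mono2) auto
    also have "\<dots> = (\<Sum>j<J. ennreal (c j * C1) * local_energy m j x) + R x"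
      unfolding R_def by (intro sum.union_disjoint) auto
    also have "(\<Sum>j<J. ennreal (c j * C1) * local_energy m j x) \<le> (\<Sum>j<J. ennreal (C1 / T) * shell_energy m j)"
    proof (intro sum_mono mult_mono local_energy_le x0 ennreal_leI)
      fix j assume "j \<in> {..<J}"
      \<comment> \<open>For \<open>j < J\<close> the truncated difference \<open>j - J\<close> is 0;
        since \<open>?n \<ge> 2\<close>, at least one factor \<open>1 / T\<close> remains.\<close>
      then have "c j = (1 / T) ^ (?n - 1)" by (simp add: c_def)
      also have "\<dots> \<le> (1 / T) ^ 1" using T n by (intro power_decreasing) auto
      finally show "c j * C1 \<le> C1 / T" using mult_right_mono[OF _ C1_nonneg] by fastforce
    qed auto
    also have "\<dots> \<le> ennreal (C1 / T) * (\<integral>\<^sup>+ y. log_energy m y \<partial>lborel)"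
      by (simp add: sum_distrib_left[symmetric] mult_left_mono sum_shell_energy_le)
    also note energy
    finally have "ennreal (M / 2) \<le> ennreal (M / 4) + R x" by (simp add: add_right_mono)
    then show ?thesis
      by (cases "R x") (auto simp flip: ennreal_plus)
  qed
  have "ennreal (M / 4) * emeasure lborel E = (\<integral>\<^sup>+ x. ennreal (M / 4) * indicator E x \<partial>lborel)"
    by (rule nn_integral_cmult_indicator[symmetric]) (simp add: E_def)
  also have "\<dots> \<le> (\<integral>\<^sup>+ x \<in> ball 0 1 - {0}. R x \<partial>lborel)"
    using lower by (intro nn_integral_mono) (auto simp: indicator_def E_def superlevel_cone_def)
  also have "\<dots> = (\<Sum>j\<in>{J..<N}. ennreal (c j * C1) * (\<integral>\<^sup>+ x \<in> ball 0 1 - {0}. local_energy m j x \<partial>lborel))"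
  proof -
    define L where "L j x = local_energy m j x * indicator (ball 0 1 - {0}) x" for j x
    have L_meas: "L j \<in> borel_measurable lborel" for j
      unfolding L_def[abs_def] measurable_lborel1
      by (intro borel_measurable_times_ennreal local_energy_measurable borel_measurable_indicator) auto
    have "(\<integral>\<^sup>+ x \<in> ball 0 1 - {0}. R x \<partial>lborel) =
        (\<integral>\<^sup>+ x. (\<Sum>j\<in>{J..<N}. ennreal (c j * C1) * L j x) \<partial>lborel)"
      by (simp only: R_def L_def sum_distrib_right mult.assoc)
    also have "\<dots> = (\<Sum>j\<in>{J..<N}. \<integral>\<^sup>+ x. ennreal (c j * C1) * L j x \<partial>lborel)"
      by (intro nn_integral_sum borel_measurable_times_ennreal borel_measurable_const L_meas)
    also have "\<dots> = (\<Sum>j\<in>{J..<N}. ennreal (c j * C1) * (\<integral>\<^sup>+ x. L j x \<partial>lborel))"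
      by (intro sum.cong refl nn_integral_cmult L_meas)
    finally show ?thesis by (simp only: L_def)
  qed
  also have "\<dots> \<le> (\<Sum>j\<in>{J..<N}. ennreal (C3 * (3 / 4) ^ J) * (ennreal (C1 / T) * shell_energy m j))"
  proof (rule sum_mono)
    fix j assume j: "j \<in> {J..<N}"
    have "ennreal (c j * C1) * (\<integral>\<^sup>+ x \<in> ball 0 1 - {0}. local_energy m j x \<partial>lborel) \<le>
        ennreal (c j * C1) * (ennreal (C3 * ((3 / 4) ^ j) ^ (?n - 1)) * shell_energy m j)"
      unfolding C3_def by (intro mult_left_mono integral_local_energy_le) auto
    also have "\<dots> = ennreal (c j * ((3 / 4) ^ j) ^ (?n - 1) * (C1 * C3)) * shell_energy m j"
    proof -
      let ?Q = "((3 / 4) ^ j) ^ (?n - 1) :: real"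
      have "c j * ?Q * (C1 * C3) = (c j * C1) * (C3 * ?Q)" by (simp only: mult_ac)
      moreover have "ennreal ((c j * C1) * (C3 * ?Q)) = ennreal (c j * C1) * ennreal (C3 * ?Q)"
        using c0[of j] C1_nonneg C3_nonneg by (intro ennreal_mult mult_nonneg_nonneg) auto
      ultimately show ?thesis by (simp only: mult.assoc)
    qed
    \<comment> \<open>The Young weight grows exactly as fast as the cone measure decays, so the
      product is independent of \<open>j\<close> and the gain \<open>(3 / 4) ^ J\<close> can be
      factored out.\<close>
    also have "c j * ((3 / 4) ^ j) ^ (?n - 1) = ((3 / 4) ^ J / T) ^ (?n - 1)"
    proof -
      have "(3 / 4 :: real) ^ j = (3 / 4) ^ (j - J) * (3 / 4) ^ J"
        using j by (simp flip: power_add)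
      then show ?thesis by (simp add: c_def flip: power_mult_distrib)
    qed
    also have "ennreal (((3 / 4) ^ J / T) ^ (?n - 1) * (C1 * C3)) \<le> ennreal ((3 / 4) ^ J / T * (C1 * C3))"
    proof (intro ennreal_leI mult_right_mono)
      have "(3 / 4) ^ J / real T \<le> 1" using q_pow(2)[of J] T by (simp add: divide_le_eq)
      then have "((3 / 4) ^ J / real T) ^ (?n - 1) \<le> ((3 / 4) ^ J / real T) ^ 1"
        using n by (intro power_decreasing) auto
      then show "((3 / 4) ^ J / real T) ^ (?n - 1) \<le> (3 / 4) ^ J / real T" by simp
    qed (use C1_nonneg C3_nonneg in auto)
    also have "ennreal ((3 / 4) ^ J / T * (C1 * C3)) = ennreal (C3 * (3 / 4) ^ J) * ennreal (C1 / T)"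
      using C1_nonneg C3_nonneg by (subst ennreal_mult[symmetric]) (simp_all add: mult_ac)
    finally show "ennreal (c j * C1) * (\<integral>\<^sup>+ x \<in> ball 0 1 - {0}. local_energy m j x \<partial>lborel) \<le>
        ennreal (C3 * (3 / 4) ^ J) * (ennreal (C1 / T) * shell_energy m j)"
      by (simp add: mult_right_mono mult.assoc)
  qed
  also have "\<dots> \<le> ennreal (C3 * (3 / 4) ^ J) * (ennreal (C1 / T) * (\<integral>\<^sup>+ y. log_energy m y \<partial>lborel))"
    by (simp add: sum_distrib_left[symmetric] mult_left_mono sum_shell_energy_le)
  also have "\<dots> \<le> ennreal (C3 * (3 / 4) ^ J) * ennreal (M / 4)"
    by (intro mult_left_mono energy) auto
  finally have "ennreal (M / 4) * emeasure lborel E \<le> ennreal (M / 4) * ennreal (C3 * (3 / 4) ^ J)"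
    by (simp add: mult.commute)
  \<comment> \<open>The same \<open>M / 4\<close> bounds \<open>R\<close> below on \<open>E\<close>
    and the weighted energy above, hence cancels.\<close>
  then have "emeasure lborel E \<le> ennreal (C3 * (3 / 4) ^ J)"
    using M1 by (subst (asm) ennreal_mult_le_mult_iff) auto
  then show ?thesis by (simp add: E_def M_def C3_def)
qed

section \<open>From the distribution of the growth to the Hardy space\<close>

text \<open>Layer decomposition along the levels \<open>\<beta> * b ^ J\<close>; the contributions
  form a geometric series of ratio \<open>b powr p * (3 / 4)\<close>.\<close>

lemma growth_power_integral_le:
  assumes \<beta>: "0 < \<beta>" and b: "1 < b" and p: "0 < p" "b powr p * (3 / 4) < 1"
    and C3: "0 \<le> C3"
    and dist: "\<And>N J. emeasure lborel (superlevel_cone N (\<beta> * b ^ J)) \<le> ennreal (C3 * (3 / 4) ^ J)"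
  shows "\<exists>K<\<infinity>. \<forall>N. (\<integral>\<^sup>+ x \<in> ball 0 1 - {0}. ennreal (growth (ray_point N x) powr p) \<partial>lborel) \<le> K"
proof (intro exI conjI allI)
  \<comment> \<open>On the layer above \<open>\<beta> * b ^ J\<close> the growth is at most the next
    level, hence \<open>Suc J\<close>.\<close>
  define h where "h J = (\<beta> * b ^ Suc J) powr p" for J
  define K where "K = ennreal (\<beta> powr p) * emeasure lborel (ball (0::real^'n) 1)
      + (\<Sum>J. ennreal (h J * (C3 * (3 / 4) ^ J)))"
  have h_nonneg: "0 \<le> h J" for J by (simp add: h_def)
  have hJ: "h J * (C3 * (3 / 4) ^ J) = (\<beta> * b) powr p * C3 * (b powr p * (3 / 4)) ^ J" for J
  proof -
    have "(b ^ J) powr p = (b powr p) ^ J"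
      using b by (simp add: powr_powr powr_power mult.commute flip: powr_realpow)
    then have "h J = (\<beta> * b) powr p * (b powr p) ^ J"
      using \<beta> b by (simp add: h_def powr_mult)
    then show ?thesis by (simp only: power_mult_distrib mult_ac)
  qed
  have summable: "summable (\<lambda>J. h J * (C3 * (3 / 4) ^ J))"
    unfolding hJ using p by (intro summable_mult summable_geometric) simp
  have "emeasure lborel (ball (0::real^'n) 1) < \<infinity>" by (rule emeasure_lborel_ball_finite)
  moreover have "(\<Sum>J. ennreal (h J * (C3 * (3 / 4) ^ J))) \<noteq> top"
    using summable h_nonneg C3 by (intro ennreal_suminf_neq_top) auto
  ultimately show "K < \<infinity>"
    unfolding K_def by (simp add: ennreal_mult_less_top less_top)
  fix N
  let ?g = "\<lambda>x. growth (ray_point N x)"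
  have pointwise: "ennreal (?g x powr p) * indicator (ball 0 1 - {0}) x \<le>
      ennreal (\<beta> powr p) * indicator (ball 0 1) x +
      (\<Sum>J. ennreal (h J) * indicator (superlevel_cone N (\<beta> * b ^ J)) x)" (is "?l \<le> ?a + ?s") for x
  proof (cases "x \<in> ball 0 1 - {0}")
    case x: True
    have g: "0 < ?g x" by (rule growth_pos[OF norm_ray_point_less])
    show ?thesis
    proof (cases "?g x \<le> \<beta>")
      case True
      then have "?l \<le> ?a" using x g p by (auto intro!: ennreal_leI powr_mono2)
      then show ?thesis by (simp add: add_increasing2)
    next
      case False
      obtain k0 where "?g x / \<beta> < b ^ k0" using real_arch_pow[OF b] by blast
      then have ex: "\<exists>k. ?g x \<le> \<beta> * b ^ k" using \<beta> by (intro exI[of _ k0]) (simp add: field_simps)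
      \<comment> \<open>The least such \<open>k\<close> is positive because
        \<open>?g x > \<beta>\<close>, and its predecessor \<open>J\<close> indexes the layer of
        \<open>x\<close>.\<close>
      define k where "k = (LEAST k. ?g x \<le> \<beta> * b ^ k)"
      have k: "?g x \<le> \<beta> * b ^ k" unfolding k_def using ex by (rule LeastI_ex)
      then obtain J where J: "k = Suc J" using False by (cases k) auto
      have "\<not> ?g x \<le> \<beta> * b ^ J"
        using not_less_Least[of J "\<lambda>k. ?g x \<le> \<beta> * b ^ k"] J unfolding k_def by simp
      then have xJ: "x \<in> superlevel_cone N (\<beta> * b ^ J)" using x by (simp add: superlevel_cone_def)
      define F where "F j = ennreal (h j) * indicator (superlevel_cone N (\<beta> * b ^ j)) x" for j
      have "?l \<le> F J"
        using x xJ k J g p unfolding F_def h_def by (auto intro!: ennreal_leI powr_mono2)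
      also have "F J = sum F {J}" by simp
      also have "\<dots> \<le> suminf F" by (rule sum_le_suminf) auto
      also have "suminf F = ?s" by (simp only: F_def[abs_def])
      finally show ?thesis by (simp add: add_increasing)
    qed
  qed simp
  have "(\<integral>\<^sup>+ x \<in> ball 0 1 - {0}. ennreal (?g x powr p) \<partial>lborel) \<le>
      (\<integral>\<^sup>+ x. ennreal (\<beta> powr p) * indicator (ball 0 1) x +
      (\<Sum>J. ennreal (h J) * indicator (superlevel_cone N (\<beta> * b ^ J)) x) \<partial>lborel)"
    by (intro nn_integral_mono pointwise)
  also have "\<dots> = ennreal (\<beta> powr p) * emeasure lborel (ball (0::real^'n) 1) +
      (\<Sum>J. ennreal (h J) * emeasure lborel (superlevel_cone N (\<beta> * b ^ J)))"
  proof -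
    define u where "u = (\<lambda>x. ennreal (\<beta> powr p) * indicator (ball (0::real^'n) 1) x)"
    define v where "v = (\<lambda>J x. ennreal (h J) * indicator (superlevel_cone N (\<beta> * b ^ J)) x)"
    have cone: "superlevel_cone N (\<beta> * b ^ J) \<in> sets lborel" for J by simp
    have u: "u \<in> borel_measurable lborel" unfolding u_def
      by (intro borel_measurable_times_ennreal borel_measurable_const borel_measurable_indicator) simp
    have v: "v J \<in> borel_measurable lborel" for J unfolding v_def
      by (intro borel_measurable_times_ennreal borel_measurable_const borel_measurable_indicator cone)
    have "(\<integral>\<^sup>+ x. u x + (\<Sum>J. v J x) \<partial>lborel) = (\<integral>\<^sup>+ x. u x \<partial>lborel) + (\<integral>\<^sup>+ x. (\<Sum>J. v J x) \<partial>lborel)"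
      by (intro nn_integral_add u borel_measurable_suminf_order v)
    also have "(\<integral>\<^sup>+ x. (\<Sum>J. v J x) \<partial>lborel) = (\<Sum>J. \<integral>\<^sup>+ x. v J x \<partial>lborel)"
      by (rule nn_integral_suminf[OF v])
    also have "\<dots> = (\<Sum>J. ennreal (h J) * emeasure lborel (superlevel_cone N (\<beta> * b ^ J)))"
      unfolding v_def by (intro suminf_cong nn_integral_cmult_indicator cone)
    also have "(\<integral>\<^sup>+ x. u x \<partial>lborel) = ennreal (\<beta> powr p) * emeasure lborel (ball (0::real^'n) 1)"
      unfolding u_def by (rule nn_integral_cmult_indicator) simp
    finally show ?thesis by (simp only: u_def v_def)
  qed
  also have "\<dots> \<le> K" unfolding K_def
  proof (intro add_left_mono suminf_le)
    fix J
    have "ennreal (h J) * emeasure lborel (superlevel_cone N (\<beta> * b ^ J)) \<le>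
        ennreal (h J) * ennreal (C3 * (3 / 4) ^ J)"
      by (intro mult_left_mono dist) auto
    then show "ennreal (h J) * emeasure lborel (superlevel_cone N (\<beta> * b ^ J)) \<le> ennreal (h J * (C3 * (3 / 4) ^ J))"
      using h_nonneg C3 by (simp add: ennreal_mult)
  qed auto
  finally show "(\<integral>\<^sup>+ x \<in> ball 0 1 - {0}. ennreal (?g x powr p) \<partial>lborel) \<le> K" .
qed

lemma rho_norm_le_growth: "norm x < 1 \<Longrightarrow> rho_norm \<rho> x \<le> growth x"
  using rho_norm_le[of x] pos[of 0] by (simp add: growth_def)

text \<open>\<open>growth\<close> increases along radii, so radius \<open>r\<close> may be replaced
  by the radius of \<open>ray_point N\<close>; this reduces a continuum of radii to a
  sequence.\<close>

lemma sphere_integral_rho_norm_le: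
  assumes p: "0 < p" and r: "0 < r" "r < 1" and N: "r \<le> 1 - (3 / 4) ^ N"
  shows "(\<integral>\<^sup>+ \<omega> \<in> sphere 0 1. ennreal (rho_norm \<rho> (r *\<^sub>R \<omega>) powr p) \<partial>sphere_measure) \<le>
    ennreal CARD('n) * (\<integral>\<^sup>+ x \<in> ball 0 1 - {0}. ennreal (growth (ray_point N x) powr p) \<partial>lborel)"
proof -
  let ?t = "1 - (3 / 4 :: real) ^ N"
  have t: "0 \<le> ?t" "?t < 1" using q_pow[of N] by auto
  define F where "F \<omega> = ennreal (indicator (sphere 0 1) \<omega> *\<^sub>R growth (?t *\<^sub>R \<omega>) powr p)" for \<omega>
  have F_meas: "F \<in> borel_measurable borel" unfolding F_def[abs_def]
  proof (rule measurable_compose[OF borel_measurable_continuous_on_indicator measurable_ennreal])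
    have "continuous_on (sphere 0 1) (\<lambda>\<omega>. growth (?t *\<^sub>R \<omega>))"
      by (rule continuous_on_compose2[OF continuous_on_growth])
         (use t in \<open>auto intro!: continuous_intros\<close>)
    moreover have "growth (?t *\<^sub>R \<omega>) \<noteq> 0" if "\<omega> \<in> sphere 0 1" for \<omega>
      using growth_pos[of "?t *\<^sub>R \<omega>"] t that by auto
    ultimately show "continuous_on (sphere 0 1) (\<lambda>\<omega>. growth (?t *\<^sub>R \<omega>) powr p)"
      by (intro continuous_on_powr continuous_on_const) auto
  qed auto
  \<comment> \<open>Passing to the Borel majorant \<open>F\<close> first avoids any measurability
    claim about \<open>rho_norm \<rho>\<close> when the image measure is unfolded.\<close>
  have "(\<integral>\<^sup>+ \<omega> \<in> sphere 0 1. ennreal (rho_norm \<rho> (r *\<^sub>R \<omega>) powr p) \<partial>sphere_measure) \<le>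
      (\<integral>\<^sup>+ \<omega>. F \<omega> \<partial>sphere_measure)"
  proof (intro nn_integral_mono)
    fix \<omega> :: "real ^ 'n"
    have "rho_norm \<rho> (r *\<^sub>R \<omega>) powr p \<le> growth (?t *\<^sub>R \<omega>) powr p" if "norm \<omega> = 1"
    proof (rule powr_mono2)
      have "rho_norm \<rho> (r *\<^sub>R \<omega>) \<le> growth (r *\<^sub>R \<omega>)"
        using r that by (intro rho_norm_le_growth) auto
      also have "\<dots> \<le> growth (?t *\<^sub>R \<omega>)"
        using that r N t by (intro growth_radial_mono) auto
      finally show "rho_norm \<rho> (r *\<^sub>R \<omega>) \<le> growth (?t *\<^sub>R \<omega>)" .
    qed (use p in \<open>auto simp: rho_norm_def rho_dist_def\<close>)
    then show "ennreal (rho_norm \<rho> (r *\<^sub>R \<omega>) powr p) * indicator (sphere 0 1) \<omega> \<le> F \<omega>"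
      by (auto simp: F_def indicator_def intro: ennreal_leI)
  qed
  also have "\<dots> = ennreal CARD('n) * (\<integral>\<^sup>+ x. F (x /\<^sub>R norm x) \<partial>restrict_space lborel (ball 0 1))"
    unfolding sphere_measure_def using F_meas
    by (subst nn_integral_scale_measure, simp, subst nn_integral_distr)
       (auto intro!: measurable_restrict_space1)
  also have "(\<integral>\<^sup>+ x. F (x /\<^sub>R norm x) \<partial>restrict_space lborel (ball 0 1)) =
      (\<integral>\<^sup>+ x \<in> ball 0 1. F (x /\<^sub>R norm x) \<partial>lborel)"
    by (rule nn_integral_restrict_space) simp
  also have "\<dots> = (\<integral>\<^sup>+ x \<in> ball 0 1 - {0}. ennreal (growth (ray_point N x) powr p) \<partial>lborel)"
  proof (intro nn_integral_cong)
    fix x :: "real ^ 'n"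
    show "F (x /\<^sub>R norm x) * indicator (ball 0 1) x =
        ennreal (growth (ray_point N x) powr p) * indicator (ball 0 1 - {0}) x"
      \<comment> \<open>At \<open>x = 0\<close> the normalized vector is \<open>0\<close>, off the
        sphere, so both sides vanish.\<close>
      by (cases "x = 0") (auto simp: F_def ray_point_def indicator_def)
  qed
  finally show ?thesis .
qed

end

theorem theorem1p3:
  fixes A B :: real
  assumes "CARD('n::finite) \<ge> 2" and "A \<ge> 1" and "B > 0"
  shows "\<exists>p0 > 0. \<forall>\<rho> :: real ^ 'n \<Rightarrow> real.
           conformal_density \<rho> \<and> satisfies_HI A \<rho> \<and> satisfies_VG B \<rho> \<longrightarrow>
           (\<forall>p. 0 < p \<and> p < p0 \<longrightarrow> in_Hp p \<rho>)"
proof -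
  let ?n = "CARD('n)"
  define C1 where "C1 = (2 * A\<^sup>2 * (1 + 2 * A\<^sup>2)) ^ ?n / unit_ball_vol ?n"
  define C3 where "C3 = 2 * 4 ^ ?n * unit_ball_vol ?n"
  obtain \<kappa> :: nat where "1 + 2 * A\<^sup>2 < real \<kappa>" using reals_Archimedean2 by blast
  then have \<kappa>: "1 + 2 * A\<^sup>2 < exp (real \<kappa>)" using exp_ge_add_one_self[of "real \<kappa>"] by linarith
  obtain T0 :: nat where T0: "4 * C1 * ((1 + real \<kappa>) * (B * exp 1 ^ ?n)) < real T0"
    using reals_Archimedean2 by blast
  \<comment> \<open>The successor secures \<open>1 \<le> T\<close>. All constants are fixed before
    \<open>\<rho>\<close> is introduced.\<close>
  define T where "T = Suc T0"
  have T: "1 \<le> T" "4 * C1 * ((1 + real \<kappa>) * (B * exp 1 ^ ?n)) \<le> real T"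
    using T0 by (auto simp: T_def)
  \<comment> \<open>Raising \<open>J\<close> by one multiplies the level
    \<open>exp (2 * T * (J + 4))\<close> by \<open>b\<close>, and \<open>p0\<close> is the exponent
    with \<open>b powr p0 * (3 / 4) = 1\<close>.\<close>
  define b where "b = exp (2 * real T)"
  define p0 where "p0 = ln (4 / 3) / (2 * real T)"
  have p0: "0 < p0" using T by (simp add: p0_def)
  show ?thesis
  proof (intro exI[of _ p0] conjI allI impI p0, elim conjE)
    fix \<rho> :: "real ^ 'n \<Rightarrow> real" and p
    assume conf: "conformal_density \<rho>" and HI: "satisfies_HI A \<rho>" and VG: "satisfies_VG B \<rho>"
      and p: "0 < p" "p < p0"
    interpret harnack_density \<rho> A
      by unfold_locales (use conf HI assms(2) in \<open>auto simp: conformal_density_def\<close>)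
    have \<rho>0: "0 < \<rho> 0" using pos by simp
    have "b powr p * (3 / 4) < 1"
    proof -
      have "2 * real T * p < ln (4 / 3)" using p T by (simp add: p0_def field_simps)
      then have "exp (2 * real T * p) < 4 / 3" using exp_less_cancel_iff[of "2 * real T * p" "ln (4 / 3)"] by simp
      then show ?thesis by (simp add: b_def powr_def ac_simps)
    qed
    moreover have "emeasure lborel (superlevel_cone N (\<rho> 0 * exp (8 * real T) * b ^ J)) \<le> ennreal (C3 * (3 / 4) ^ J)" for N J
    proof -
      \<comment> \<open>The factor \<open>exp (8 * T)\<close> is the offset 4 in
        \<open>J + 4\<close>.\<close>
      have "\<rho> 0 * exp (8 * real T) * b ^ J = \<rho> 0 * exp (real (2 * T * (J + 4)))"
        by (simp add: b_def algebra_simps flip: exp_of_nat_mult exp_add)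
      then show ?thesis
        using emeasure_superlevel_cone_le[OF assms(1) VG less_imp_le[OF assms(3)] \<kappa> C1_def T, of N J]
        by (simp only: C3_def)
    qed
    ultimately obtain K where K: "K < \<infinity>"
      "\<And>N. (\<integral>\<^sup>+ x \<in> ball 0 1 - {0}. ennreal (growth (ray_point N x) powr p) \<partial>lborel) \<le> K"
      using growth_power_integral_le[of "\<rho> 0 * exp (8 * real T)" b p C3] \<rho>0 p T
      by (auto simp: b_def C3_def)
    have "(SUP r \<in> {0<..<1}. \<integral>\<^sup>+ \<omega> \<in> sphere 0 1. ennreal ((1 * rho_norm \<rho> (r *\<^sub>R \<omega>)) powr p) \<partial>sphere_measure)
        \<le> ennreal ?n * K"
    proof (rule SUP_least)
      fix r :: real assume r: "r \<in> {0<..<1}"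
      obtain N where "(3 / 4 :: real) ^ N < 1 - r"
        using real_arch_pow_inv[of "1 - r" "3 / 4"] r by auto
      then show "(\<integral>\<^sup>+ \<omega> \<in> sphere 0 1. ennreal ((1 * rho_norm \<rho> (r *\<^sub>R \<omega>)) powr p) \<partial>sphere_measure) \<le> ennreal ?n * K"
        using sphere_integral_rho_norm_le[of p r N] r p mult_left_mono[OF K(2)[of N], of "ennreal ?n"]
        by (auto intro: order_trans)
    qed
    also have "\<dots> < \<infinity>" using K(1) by (simp add: ennreal_mult_less_top)
    \<comment> \<open>\<open>\<delta> = 1\<close> suffices, since \<open>K\<close> may depend on
      \<open>\<rho>\<close>.\<close>
    finally show "in_Hp p \<rho>" unfolding in_Hp_def by (intro exI[of _ 1]) auto
  qed
qed

end
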